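(* Let $(A_n)_{n\in\mathbb{N}}$ be a sequence of analytic subsets of $[-\tfrac12,\tfrac12)^d\subset\mathbb{R}^d$, and for $\mathbf{x}=(x_n)_{n\in\mathbb{N}}\in\Omega=(\mathbb{T}^d)^{\mathbb{N}}$ let $E(\mathbf{x})=\limsup_{n\to\infty}(x_n+\Pi(A_n))\subset\mathbb{T}^d$. Let $s_0$ be the $\mathbb{P}$-almost sure value of the Hausdorff dimension of $E(\mathbf{x})$. Let $F\subset\mathbb{T}^d$ be analytic. Then for $\mathbb{P}$-almost all $\mathbf{x}\in\Omega$, $$E(\mathbf{x})\cap F=\emptyset\quad\text{if }\dim_{\mathrm P}F<d-s_0,$$ and $$\dim_{\mathrm H}(E(\mathbf{x})\cap F)\le s_0+\dim_{\mathrm P}F-d\quad\text{if }\dim_{\mathrm P}F\ge d-s_0.$$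
   Context: $\mathbb{T}^d$ is the $d$-dimensional torus, identified with $[-\tfrac12,\tfrac12)^d$, with its natural (locally Euclidean) metric and group structure; $\Pi\colon\mathbb{R}^d\to\mathbb{T}^d$ is the natural covering map, and $\mathcal{L}$ is Lebesgue measure on $\mathbb{T}^d$. $(\Omega,\mathcal A,\mathbb{P})$ is the completion of the infinite product of countably many copies of $(\mathbb{T}^d,\mathcal B(\mathbb{T}^d),\mathcal{L})$, so the $x_n$ are independent and uniformly distributed. $\limsup_{n\to\infty}Z_n=\bigcap_{k\in\mathbb{N}}\bigcup_{n=k}^\infty Z_n$. By Kolmogorov's zero-one law there is a unique $s_0\in[0,d]$ with $\dim_{\mathrm H}E(\mathbf{x})=s_0$ for $\mathbb{P}$-almost all $\mathbf{x}\in\Omega$. $\dim_{\mathrm H}$ and $\dim_{\mathrm P}$ are Hausdorff and packing dimension; the dimension of the empty set is $0$. A set is analytic if it is a continuous image of a Borel set. *)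

theory Defs
  imports "HOL-Probability.Probability"
begin

section \<open>The torus\<close>

definition torus_rel :: "real^'n \<Rightarrow> real^'n \<Rightarrow> bool" where
  "torus_rel u v \<longleftrightarrow> (\<forall>i. u $ i - v $ i \<in> \<int>)"

lemma equivp_torus_rel: "equivp torus_rel"
proof (intro equivpI reflpI sympI transpI)
  show "torus_rel u u" for u :: "real^'n"
    by (simp add: torus_rel_def)
next
  show "torus_rel v u" if "torus_rel u v" for u v :: "real^'n"
    unfolding torus_rel_def
  proof
    fix i
    have "- (u $ i - v $ i) \<in> \<int>"
      using that unfolding torus_rel_def by (intro Ints_minus) blast
    then show "v $ i - u $ i \<in> \<int>" by simp
  qed
next
  show "torus_rel u w" if "torus_rel u v" "torus_rel v w" for u v w :: "real^'n"
    unfolding torus_rel_def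
  proof
    fix i
    have "(u $ i - v $ i) + (v $ i - w $ i) \<in> \<int>"
      using that unfolding torus_rel_def by (intro Ints_add) blast+
    then show "u $ i - w $ i \<in> \<int>" by simp
  qed
qed

quotient_type (overloaded) 'n torus = "real^'n::finite" / torus_rel
  morphisms rep_torus torus_proj
  by (rule equivp_torus_rel)

text \<open>
  \<^const>\<open>torus_proj\<close> is the covering map. A point of the torus has exactly one
  representative in the following cube.
\<close>

definition torus_cube :: "(real^'n) set" where
  "torus_cube = {u. \<forall>i. - 1/2 \<le> u $ i \<and> u $ i < 1/2}"

lemma torus_proj_eq_iff: "torus_proj u = torus_proj v \<longleftrightarrow> torus_rel u v"
  by (rule torus.abs_eq_iff)

lemma torus_proj_surj: "\<exists>u. torus_proj u = x"
  by (metis Quotient3_abs_rep Quotient3_torus)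

lemma bij_betw_torus_proj: "bij_betw torus_proj (torus_cube :: (real^'n) set) UNIV"
proof (rule bij_betw_imageI)
  show "inj_on torus_proj (torus_cube :: (real^'n) set)"
  proof (rule inj_onI)
    fix u v :: "real^'n"
    assume u: "u \<in> torus_cube" and v: "v \<in> torus_cube" and eq: "torus_proj u = torus_proj v"
    show "u = v"
      unfolding vec_eq_iff
    proof
      fix i
      obtain k :: int where k: "u $ i - v $ i = of_int k"
        using eq unfolding torus_proj_eq_iff torus_rel_def by (meson Ints_cases)
      have "\<bar>u $ i - v $ i\<bar> < 1"
        using u v unfolding torus_cube_def by (smt (verit) field_sum_of_halves mem_Collect_eq)
      with k have "\<bar>k\<bar> < 1" by linarith
      with k show "u $ i = v $ i" by simp
    qed
  qed
  have "x \<in> torus_proj ` torus_cube" for x :: "'n torus"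
  proof -
    obtain u where u: "torus_proj u = x" using torus_proj_surj by blast
    define v where "v = (\<chi> i. u $ i - of_int (round (u $ i)))"
    have "torus_proj v = x"
      unfolding u[symmetric] torus_proj_eq_iff torus_rel_def v_def by simp
    moreover have "v \<in> torus_cube"
      unfolding torus_cube_def v_def round_def by (auto; linarith)
    ultimately show ?thesis by blast
  qed
  then show "torus_proj ` torus_cube = (UNIV :: 'n torus set)" by blast
qed

instantiation torus :: (finite) ab_group_add
begin

lift_definition zero_torus :: "'a torus" is 0 .

lift_definition plus_torus :: "'a torus \<Rightarrow> 'a torus \<Rightarrow> 'a torus" is "(+)"
proof -
  fix u v u' v' :: "real^'a"
  assume "torus_rel u v" "torus_rel u' v'"
  then have "(u $ i - v $ i) + (u' $ i - v' $ i) \<in> \<int>" for i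
    unfolding torus_rel_def by (intro Ints_add) blast+
  then show "torus_rel (u + u') (v + v')"
    unfolding torus_rel_def by (simp add: algebra_simps)
qed

lift_definition uminus_torus :: "'a torus \<Rightarrow> 'a torus" is uminus
proof -
  fix u v :: "real^'a"
  assume "torus_rel u v"
  then have "- (u $ i - v $ i) \<in> \<int>" for i
    unfolding torus_rel_def by (intro Ints_minus) blast
  then show "torus_rel (- u) (- v)"
    unfolding torus_rel_def by simp
qed

lift_definition minus_torus :: "'a torus \<Rightarrow> 'a torus \<Rightarrow> 'a torus" is "(-)"
proof -
  fix u v u' v' :: "real^'a"
  assume "torus_rel u v" "torus_rel u' v'"
  then have "(u $ i - v $ i) - (u' $ i - v' $ i) \<in> \<int>" for i
    unfolding torus_rel_def by (blast intro: Ints_diff[of "u $ i - v $ i" "u' $ i - v' $ i"])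
  then show "torus_rel (u - u') (v - v')"
    unfolding torus_rel_def by (simp add: algebra_simps)
qed

instance
  by standard (transfer; simp add: torus_rel_def)+

end

text \<open>
  The quotient metric: the distance of two points is the least distance of
  representatives.
\<close>

definition torus_dist :: "'n::finite torus \<Rightarrow> 'n torus \<Rightarrow> real" where
  "torus_dist x y = (INF (u, v)\<in>{(u, v). torus_proj u = x \<and> torus_proj v = y}. dist u v)"

lemma torus_dist_le: "torus_dist (torus_proj u) (torus_proj v) \<le> dist u v"
proof -
  have "bdd_below ((\<lambda>(u, v). dist u v) ` {(u', v'). torus_proj u' = torus_proj u \<and> torus_proj v' = torus_proj v})"
    by (rule bdd_belowI[where m = 0]) auto
  then show ?thesis
    unfolding torus_dist_def by (rule cINF_lower2[where x = "(u, v)"]) auto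
qed

lemma torus_dist_attained:
  assumes u: "torus_proj u = x"
  obtains v where "torus_proj v = y" "torus_dist x y = dist u v"
proof -
  obtain v0 where v0: "torus_proj v0 = y" using torus_proj_surj by blast
  define v where "v = (\<chi> i. v0 $ i + of_int (round (u $ i - v0 $ i)))"
  have v: "torus_proj v = y"
    unfolding v0[symmetric] torus_proj_eq_iff torus_rel_def v_def by simp
  have "dist u v \<le> dist u' v'" if "torus_proj u' = x" "torus_proj v' = y" for u' v'
    unfolding dist_norm
  proof (rule norm_le_componentwise_cart)
    fix i
    have "torus_rel u u'" "torus_rel v0 v'"
      using that u v0 by (simp_all flip: torus_proj_eq_iff)
    then obtain k l :: int where k: "u $ i - u' $ i = of_int k" and l: "v0 $ i - v' $ i = of_int l"
      unfolding torus_rel_def by (meson Ints_cases)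
    have "\<bar>(u $ i - v0 $ i) - of_int (round (u $ i - v0 $ i))\<bar>
        \<le> \<bar>(u $ i - v0 $ i) - of_int (k - l)\<bar>"
      by (rule round_diff_minimal)
    also have "(u $ i - v0 $ i) - of_int (k - l) = u' $ i - v' $ i"
      using k l by simp
    finally show "norm ((u - v) $ i) \<le> norm ((u' - v') $ i)"
      by (simp add: v_def algebra_simps)
  qed
  then have "dist u v \<le> torus_dist x y"
    unfolding torus_dist_def using u v by (intro cINF_greatest) auto
  with torus_dist_le[of u v] u v that show ?thesis by force
qed

instantiation torus :: (finite) metric_space
begin

definition dist_torus :: "'a torus \<Rightarrow> 'a torus \<Rightarrow> real" where
  "dist_torus = torus_dist"

definition uniformity_torus :: "('a torus \<times> 'a torus) filter" where
  "uniformity_torus = (INF e\<in>{0<..}. principal {(x, y). dist x y < e})"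

definition open_torus :: "'a torus set \<Rightarrow> bool" where
  "open_torus U \<longleftrightarrow> (\<forall>x\<in>U. eventually (\<lambda>(x', y). x' = x \<longrightarrow> y \<in> U) uniformity)"

instance
proof
  fix x y z :: "'a torus"
  show "dist x y = 0 \<longleftrightarrow> x = y"
  proof
    assume 0: "dist x y = 0"
    obtain u where u: "torus_proj u = x" using torus_proj_surj by blast
    then obtain v where "torus_proj v = y" "torus_dist x y = dist u v"
      by (rule torus_dist_attained)
    with 0 u show "x = y" by (simp add: dist_torus_def)
  next
    assume "x = y"
    obtain u where u: "torus_proj u = x" using torus_proj_surj by blast
    then obtain v where "torus_proj v = y" "torus_dist x y = dist u v"
      by (rule torus_dist_attained)
    then show "dist x y = 0"
      using \<open>x = y\<close> u torus_dist_le[of u u] by (simp add: dist_torus_def)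
  qed
  obtain w where w: "torus_proj w = z" using torus_proj_surj by blast
  obtain u where u: "torus_proj u = x" "torus_dist z x = dist w u"
    using torus_dist_attained[OF w] by metis
  obtain v where v: "torus_proj v = y" "torus_dist z y = dist w v"
    using torus_dist_attained[OF w] by metis
  have sym: "torus_dist a b = torus_dist b a" for a b :: "'a torus"
  proof -
    have "torus_dist a b \<le> torus_dist b a" for a b :: "'a torus"
    proof -
      obtain u where u: "torus_proj u = b" using torus_proj_surj by blast
      obtain v where "torus_proj v = a" "torus_dist b a = dist u v"
        using torus_dist_attained[OF u] by metis
      with u torus_dist_le[of v u] show ?thesis by (simp add: dist_commute)
    qed
    then show ?thesis by (meson antisym)
  qed
  have "torus_dist x y \<le> dist u v"
    using u(1) v(1) torus_dist_le[of u v] by simp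
  also have "\<dots> \<le> dist w u + dist w v"
    by (rule dist_triangle3)
  finally show "dist x y \<le> dist x z + dist y z"
    using u(2) v(2) sym by (simp add: dist_torus_def)
qed (simp_all add: uniformity_torus_def open_torus_def)

end

lemma continuous_on_torus_proj: "continuous_on S torus_proj"
proof -
  have "1-lipschitz_on S torus_proj"
    by (rule lipschitz_onI) (simp_all add: dist_torus_def torus_dist_le)
  then show ?thesis by (rule lipschitz_on_continuous_on)
qed

definition torus_lebesgue :: "('n::finite torus) measure" where
  "torus_lebesgue = distr (restrict_space lborel torus_cube) borel torus_proj"

lemma torus_cube_borel: "torus_cube \<in> sets borel"
proof -
  have "torus_cube = (\<Inter>i. {u :: real^'n. - 1/2 \<le> u $ i}) \<inter> (\<Inter>i. {u. u $ i < 1/2})"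
    unfolding torus_cube_def by auto
  also have "\<dots> \<in> sets borel"
    by measurable
  finally show ?thesis .
qed

lemma prob_space_torus_lebesgue: "prob_space (torus_lebesgue :: ('n::finite torus) measure)"
proof -
  let ?a = "(\<chi> i. - 1/2) :: real^'n" and ?b = "(\<chi> i. 1/2) :: real^'n"
  have vol: "emeasure lborel (cbox ?a ?b) = 1" "emeasure lborel (box ?a ?b) = 1"
    by (auto simp: emeasure_lborel_cbox_eq emeasure_lborel_box_eq Basis_vec_def inner_axis
        intro!: prod.neutral)
  have sub: "box ?a ?b \<subseteq> torus_cube" "torus_cube \<subseteq> cbox ?a ?b"
    by (auto simp: torus_cube_def mem_box_cart less_imp_le)
  have "emeasure lborel (torus_cube :: (real^'n) set) = 1"
    using emeasure_mono[OF sub(1), of lborel] emeasure_mono[OF sub(2), of lborel]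
    unfolding vol by (intro antisym) (simp_all add: torus_cube_borel)
  then have "prob_space (restrict_space lborel (torus_cube :: (real^'n) set))"
    by (intro prob_spaceI)
      (simp add: torus_cube_borel emeasure_restrict_space space_restrict_space)
  moreover have "torus_proj \<in> restrict_space lborel (torus_cube :: (real^'n) set) \<rightarrow>\<^sub>M borel"
    by (intro measurable_restrict_space1)
      (simp add: borel_measurable_continuous_onI[OF continuous_on_torus_proj])
  ultimately show ?thesis
    unfolding torus_lebesgue_def by (rule prob_space.prob_space_distr)
qed

definition torus_seq_measure :: "(nat \<Rightarrow> 'n::finite torus) measure" where
  "torus_seq_measure = completion (PiM UNIV (\<lambda>_. torus_lebesgue))"

definition random_covering_set :: "(nat \<Rightarrow> (real^'n) set) \<Rightarrow> (nat \<Rightarrow> 'n::finite torus) \<Rightarrow> 'n torus set" where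
  "random_covering_set A x = (\<Inter>k. \<Union>n\<in>{k..}. (\<lambda>y. x n + y) ` torus_proj ` A n)"


section \<open>Analytic sets\<close>

text \<open>
  An analytic set is a continuous image of a Borel set of some Polish space. HOL cannot
  quantify over the Polish space, but it is enough to consider the countable product of
  lines: every Polish space is homeomorphic to a Borel subset of it.
\<close>

definition analytic_set :: "'a::topological_space set \<Rightarrow> bool" where
  "analytic_set S \<longleftrightarrow>
     (\<exists>(B :: (nat \<Rightarrow> real) set) f. B \<in> sets borel \<and> continuous_on B f \<and> f ` B = S)"


section \<open>Hausdorff dimension\<close>

text \<open>
  The power diam(U)^s, with the convention that it is 0 for empty U and 1 for
  nonempty U if s = 0, so that 0-dimensional Hausdorff measure is counting measure.
  (Note that \<open>0 powr 0 = 0\<close>.)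
\<close>

definition diam_powr :: "real \<Rightarrow> 'a::metric_space set \<Rightarrow> ennreal" where
  "diam_powr s U = (if U = {} then 0 else if s = 0 then 1 else ennreal (diameter U powr s))"

text \<open>
  Boundedness is required since the library's \<^const>\<open>diameter\<close> is only meaningful for
  bounded sets.
\<close>

definition hausdorff_premeasure :: "real \<Rightarrow> real \<Rightarrow> 'a::metric_space set \<Rightarrow> ennreal" where
  "hausdorff_premeasure s \<delta> S =
     (INF U\<in>{U :: nat \<Rightarrow> 'a set. S \<subseteq> (\<Union>i. U i) \<and> (\<forall>i. bounded (U i) \<and> diameter (U i) \<le> \<delta>)}.
        \<Sum>i. diam_powr s (U i))"

definition hausdorff_measure :: "real \<Rightarrow> 'a::metric_space set \<Rightarrow> ennreal" where
  "hausdorff_measure s S = (SUP \<delta>\<in>{0<..}. hausdorff_premeasure s \<delta> S)"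

definition hausdorff_dim :: "'a::metric_space set \<Rightarrow> ereal" where
  "hausdorff_dim S = Inf {ereal s | s. 0 \<le> s \<and> hausdorff_measure s S = 0}"


section \<open>Packing dimension\<close>

text \<open>
  A \<open>\<delta>\<close>-packing of S is a disjoint family of closed balls with centres in S and radii at
  most \<open>\<delta>\<close>, represented as a set of pairs of centre and radius. Taking the supremum over
  finite packings gives the same value as over countable ones. A ball of radius r
  contributes \<open>(2r)^s\<close>; on the torus \<open>2r\<close> is its diameter if r is at most 1/4.
\<close>

definition is_packing :: "real \<Rightarrow> 'a::metric_space set \<Rightarrow> ('a \<times> real) set \<Rightarrow> bool" where
  "is_packing \<delta> S P \<longleftrightarrow>
     (\<forall>(x, r)\<in>P. x \<in> S \<and> 0 < r \<and> r \<le> \<delta>) \<and>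
     pairwise (\<lambda>(x, r) (y, q). disjnt (cball x r) (cball y q)) P"

definition packing_premeasure_at :: "real \<Rightarrow> real \<Rightarrow> 'a::metric_space set \<Rightarrow> ennreal" where
  "packing_premeasure_at s \<delta> S =
     (SUP P\<in>{P. finite P \<and> is_packing \<delta> S P}. \<Sum>(x, r)\<in>P. ennreal ((2 * r) powr s))"

definition packing_premeasure :: "real \<Rightarrow> 'a::metric_space set \<Rightarrow> ennreal" where
  "packing_premeasure s S = (INF \<delta>\<in>{0<..}. packing_premeasure_at s \<delta> S)"

definition packing_measure :: "real \<Rightarrow> 'a::metric_space set \<Rightarrow> ennreal" where
  "packing_measure s S =
     (INF C\<in>{C :: nat \<Rightarrow> 'a set. S \<subseteq> (\<Union>i. C i)}. \<Sum>i. packing_premeasure s (C i))"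

definition packing_dim :: "'a::metric_space set \<Rightarrow> ereal" where
  "packing_dim S = Inf {ereal s | s. 0 \<le> s \<and> packing_measure s S = 0}"

lemma hausdorff_dim_empty: "hausdorff_dim {} = 0"
proof -
  have "hausdorff_premeasure 0 \<delta> ({} :: 'a set) \<le> 0" if "0 < \<delta>" for \<delta>
    unfolding hausdorff_premeasure_def
    by (rule INF_lower2[where i = "\<lambda>_. {}"]) (use that in \<open>auto simp: diam_powr_def\<close>)
  then have "hausdorff_measure 0 ({} :: 'a set) = 0"
    unfolding hausdorff_measure_def by (intro antisym SUP_least) auto
  then have "hausdorff_dim ({} :: 'a set) \<le> ereal 0"
    unfolding hausdorff_dim_def by (intro Inf_lower) auto
  moreover have "0 \<le> hausdorff_dim ({} :: 'a set)"
    unfolding hausdorff_dim_def by (intro Inf_greatest) auto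
  ultimately show ?thesis by (simp add: zero_ereal_def antisym)
qed

lemma packing_dim_empty: "packing_dim {} = 0"
proof -
  have "is_packing \<delta> ({} :: 'a set) P \<longleftrightarrow> P = {}" for \<delta> P
    by (auto simp: is_packing_def)
  then have "packing_premeasure_at 0 1 ({} :: 'a set) = 0"
    by (simp add: packing_premeasure_at_def)
  then have "packing_premeasure 0 ({} :: 'a set) \<le> 0"
    unfolding packing_premeasure_def by (intro INF_lower2[where i = 1]) auto
  then have "packing_measure 0 ({} :: 'a set) \<le> 0"
    unfolding packing_measure_def by (intro INF_lower2[where i = "\<lambda>_. {}"]) auto
  then have "packing_dim ({} :: 'a set) \<le> ereal 0"
    unfolding packing_dim_def by (intro Inf_lower) auto
  moreover have "0 \<le> packing_dim ({} :: 'a set)"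
    unfolding packing_dim_def by (intro Inf_greatest) auto
  ultimately show ?thesis by (simp add: zero_ereal_def antisym)
qed

end

theory Submission
  imports Defs
begin

text \<open>
  Shifting all \<open>x n\<close> by the same point \<open>a\<close> preserves their joint
  law and translates the covering set by \<open>a\<close>. So the assertion is a statement about a typical
  translate of a fixed set \<open>E\<close> of dimension \<open>s\<^sub>0\<close>, and there it is Marstrand's slicing estimate: for
  almost every \<open>a\<close>, the set \<open>(E + a) \<inter> F\<close> has dimension at most \<open>dim\<^sub>H E + dim\<^sub>P F - d\<close>, and it is
  empty if this number is negative. To see this, cover \<open>E\<close> by dyadic cells of side \<open>2^-k\<close>, and
  recall that a set of finite \<open>p\<close>-dimensional packing premeasure meets \<open>O(2^(k p))\<close> cells of that
  side. A translate of one cell meets another one with probability \<open>O(2^(-k d))\<close>. Hence the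
  expected \<open>t\<close>-dimensional size of the cover of \<open>(E + a) \<inter> F\<close> by cells is \<open>O\<close> of the sum of
  \<open>2^(-k (t + d - p))\<close> over the cells covering \<open>E\<close>, which is small if \<open>t + d - p\<close> is at least \<open>s\<close>
  and \<open>E\<close> has \<open>s\<close>-dimensional measure zero (\<open>AE_translate_inter_content_null\<close>). The case \<open>t = 0\<close> gives
  emptiness, because a set of \<open>0\<close>-dimensional content zero is empty.

  By Fubini's theorem a set of sequences \<open>x\<close> is null if for almost every \<open>x\<close> almost every translate
  of \<open>x\<close> avoids it, but this needs a measurable set, and the set of all \<open>x\<close> such that
  \<open>E(x) \<inter> F\<close> has positive content is not given in a measurable form. Here analyticity enters.
  The graph \<open>{(x, z). z \<in> E(x) \<inter> F}\<close> is analytic, that is, the projection of a closed set. Measure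
  the size of a subset \<open>H\<close> of the product by the outer probability that the section of \<open>H\<close> at \<open>x\<close> has
  content above a threshold. This is a capacity in the sense of Choquet, so that a graph of positive size
  contains a closed set of positive size (\<open>choquet_bounds\<close>, \<open>INT_closure_bounded_witness\<close>). For
  closed sets the exceptional event is closed, and Fubini's theorem applies
  (\<open>AE_section_content_null\<close>).

  A capacity has to be continuous along increasing sequences of sets. To have this property, sizes
  are measured by the net content, in which a set may only be covered by dyadic cells: two
  cells are either disjoint or nested, which makes the content strongly subadditive and thereby
  continuous (\<open>content_UN_incseq\<close>). It has the same null sets as Hausdorff measure.
\<close>


section \<open>Net contents\<close>

text \<open>
  The \<open>t\<close>-th power of the side \<open>2^-k\<close> of a cell named by \<open>(k, c)\<close>. It equals \<open>1\<close> for \<open>t = 0\<close>, so that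
  a set with a cover of weight below \<open>1\<close> is empty in dimension zero.
\<close>

definition scale_weight :: "real \<Rightarrow> nat \<times> 'c \<Rightarrow> ennreal" where
  "scale_weight t q = ennreal (((1/2) ^ fst q) powr t)"

text \<open>
  The sum of the weights of a family of cells. Writing it as a measure makes countable
  (sub)additivity and continuity available.
\<close>

definition weight :: "real \<Rightarrow> (nat \<times> 'c) set \<Rightarrow> ennreal" where
  "weight t I = emeasure (density (count_space UNIV) (scale_weight t)) I"

lemma weight_eq: "weight t I = (\<integral>\<^sup>+q. scale_weight t q * indicator I q \<partial>count_space UNIV)"
  unfolding weight_def by (simp add: emeasure_density)

lemma weight_empty [simp]: "weight t {} = 0"
  unfolding weight_def by simp

lemma weight_mono: "I \<subseteq> J \<Longrightarrow> weight t I \<le> weight t J"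
  unfolding weight_def by (rule emeasure_mono) auto

lemma weight_Un_disjoint: "I \<inter> J = {} \<Longrightarrow> weight t (I \<union> J) = weight t I + weight t J"
  unfolding weight_def by (rule plus_emeasure[symmetric]) auto

lemma weight_UN_le: "weight t (\<Union>n::nat. I n) \<le> (\<Sum>n. weight t (I n))"
  unfolding weight_def by (rule emeasure_subadditive_countably) auto

lemma weight_UN_incseq: "incseq I \<Longrightarrow> weight t (\<Union>n. I n) = (SUP n. weight t (I n))"
  unfolding weight_def by (rule SUP_emeasure_incseq[symmetric]) auto

lemma weight_finite: "finite I \<Longrightarrow> weight t I = (\<Sum>q\<in>I. scale_weight t q)"
  unfolding weight_eq
  by (subst nn_integral_count_space'[where A = I]) (auto simp: indicator_def)

lemma scale_weight_le_weight: "q \<in> I \<Longrightarrow> scale_weight t q \<le> weight t I"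
  using weight_mono[of "{q}" I t] by (simp add: weight_finite)

text \<open>
  At level \<open>k\<close> the sets \<open>{z. code k z = c}\<close> form a partition, and the partitions become finer with
  increasing \<open>k\<close>. A cell is named by the pair \<open>(k, c)\<close>; this is unambiguous at a point \<open>z\<close>, whose only
  cell of level \<open>k\<close> is named by \<open>(k, code k z)\<close>.
\<close>

locale nested_partitions =
  fixes code :: "nat \<Rightarrow> 'a \<Rightarrow> 'c"
  assumes code_nested: "l \<le> k \<Longrightarrow> code k z = code k z' \<Longrightarrow> code l z = code l z'"
begin

definition covered :: "(nat \<times> 'c) set \<Rightarrow> 'a set" where
  "covered I = {z. \<exists>k. (k, code k z) \<in> I}"

definition content :: "real \<Rightarrow> 'a set \<Rightarrow> ennreal" where
  "content t S = (INF I\<in>{I. S \<subseteq> covered I}. weight t I)"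

lemma covered_mono: "I \<subseteq> J \<Longrightarrow> covered I \<subseteq> covered J"
  unfolding covered_def by blast

lemma content_le: "S \<subseteq> covered I \<Longrightarrow> content t S \<le> weight t I"
  unfolding content_def by (rule INF_lower) simp

lemma content_mono: "S \<subseteq> S' \<Longrightarrow> content t S \<le> content t S'"
  unfolding content_def by (rule INF_superset_mono) auto

lemma content_less_cover:
  assumes "content t S < a"
  obtains I where "S \<subseteq> covered I" "weight t I < a"
  using assms unfolding content_def INF_less_iff by auto

lemma content_near_cover:
  assumes "content t S < \<infinity>" "0 < e"
  obtains I where "S \<subseteq> covered I" "weight t I \<le> content t S + ennreal e"
proof -
  have "content t S < content t S + ennreal e"
    using assms ennreal_add_left_cancel_less[of "content t S" 0 "ennreal e"] by (simp add: less_top)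
  then show ?thesis by (rule content_less_cover) (use that in \<open>auto intro: less_imp_le\<close>)
qed

lemma content_UN_null:
  assumes "\<And>n::nat. content t (S n) = 0"
  shows "content t (\<Union>n. S n) = 0"
proof -
  have "content t (\<Union>n. S n) \<le> ennreal e" if e: "0 < e" for e :: real
  proof -
    have "\<exists>I. S n \<subseteq> covered I \<and> weight t I \<le> ennreal (e * (1/2) ^ Suc n)" for n
      using content_near_cover[of t "S n" "e * (1/2) ^ Suc n"] e assms[of n] by auto
    then obtain I where I: "\<And>n. S n \<subseteq> covered (I n)"
      "\<And>n. weight t (I n) \<le> ennreal (e * (1/2) ^ Suc n)" by metis
    have "(\<Union>n. S n) \<subseteq> covered (\<Union>n. I n)"
      using I(1) unfolding covered_def by blast
    then have "content t (\<Union>n. S n) \<le> weight t (\<Union>n. I n)" by (rule content_le)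
    also have "\<dots> \<le> (\<Sum>n. weight t (I n))" by (rule weight_UN_le)
    also have "\<dots> \<le> (\<Sum>n. ennreal (e * (1/2) ^ Suc n))" by (intro suminf_le I(2)) auto
    also have "\<dots> = ennreal (e * 1)"
      using sums_mult[OF power_half_series, of e] e by (intro suminf_ennreal_eq) auto
    finally show ?thesis by simp
  qed
  then show ?thesis
    using ennreal_le_epsilon[of 0 "content t (\<Union>n. S n)"] by (simp add: le_zero_eq)
qed

definition maximal_cells :: "(nat \<times> 'c) set \<Rightarrow> (nat \<times> 'c) set" where
  "maximal_cells I = {(k, c) \<in> I. \<forall>z. code k z = c \<longrightarrow> (\<forall>l<k. (l, code l z) \<notin> I)}"

lemma maximal_cells_subset: "maximal_cells I \<subseteq> I"
  unfolding maximal_cells_def by auto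

lemma maximal_cells_antimono: "I \<subseteq> J \<Longrightarrow> maximal_cells J \<inter> I \<subseteq> maximal_cells I"
  unfolding maximal_cells_def by auto

lemma covered_maximal_cells: "covered (maximal_cells I) = covered I"
proof
  show "covered (maximal_cells I) \<subseteq> covered I"
    by (rule covered_mono[OF maximal_cells_subset])
  show "covered I \<subseteq> covered (maximal_cells I)"
  proof
    fix z assume "z \<in> covered I"
    then have ex: "\<exists>k. (k, code k z) \<in> I" unfolding covered_def by simp
    define k where "k = (LEAST k. (k, code k z) \<in> I)"
    have k: "(k, code k z) \<in> I" unfolding k_def using ex by (rule LeastI_ex)
    have "(l, code l z) \<notin> I" if "l < k" for l
      using that unfolding k_def by (rule not_less_Least)
    then have "(l, code l z') \<notin> I" if "code k z' = code k z" "l < k" for l z'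
      using code_nested[of l k z' z] that by auto
    with k have "(k, code k z) \<in> maximal_cells I" unfolding maximal_cells_def by auto
    then show "z \<in> covered (maximal_cells I)" unfolding covered_def by blast
  qed
qed

text \<open>
  Strong subadditivity. Of two families, keep for the union the maximal cells of
  both together. A point in both covers lies in a maximal cell of either family; the smaller of
  these two cells has either been discarded or belongs to both families. So what is left over
  covers the intersection.
\<close>

lemma weight_maximal_cells_Un:
  "weight t (maximal_cells (I \<union> J)) + content t (covered I \<inter> covered J)
     \<le> weight t (maximal_cells I) + weight t J"
proof -
  let ?A = "maximal_cells I" and ?B = "maximal_cells J" and ?U = "maximal_cells (I \<union> J)"
  define V where "V = ((?A \<union> ?B) - ?U) \<union> (?A \<inter> ?B)"
  have sub: "?U \<subseteq> ?A \<union> ?B"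
    using maximal_cells_subset[of "I \<union> J"] maximal_cells_antimono[of I "I \<union> J"]
      maximal_cells_antimono[of J "I \<union> J"] by auto
  have "covered I \<inter> covered J \<subseteq> covered V"
  proof
    fix z assume "z \<in> covered I \<inter> covered J"
    then obtain k l where kl: "(k, code k z) \<in> ?A" "(l, code l z) \<in> ?B"
      unfolding covered_maximal_cells[of I, symmetric] covered_maximal_cells[of J, symmetric]
      by (auto simp: covered_def)
    then have IJ: "(k, code k z) \<in> I" "(l, code l z) \<in> J" using maximal_cells_subset by auto
    consider "k = l" | "k < l" | "l < k" by linarith
    then show "z \<in> covered V"
    proof cases
      case 1
      then show ?thesis using kl unfolding V_def covered_def by auto
    next
      case 2
      then have "(l, code l z) \<notin> ?U" using IJ unfolding maximal_cells_def by auto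
      then show ?thesis using kl unfolding V_def covered_def by auto
    next
      case 3
      then have "(k, code k z) \<notin> ?U" using IJ unfolding maximal_cells_def by auto
      then show ?thesis using kl unfolding V_def covered_def by auto
    qed
  qed
  then have "weight t ?U + content t (covered I \<inter> covered J) \<le> weight t ?U + weight t V"
    by (intro add_left_mono content_le)
  also have "\<dots> \<le> weight t ?U + (weight t ((?A \<union> ?B) - ?U) + weight t (?A \<inter> ?B))"
    unfolding V_def weight_def by (intro add_left_mono emeasure_subadditive) auto
  also have "\<dots> = weight t (?U \<union> ((?A \<union> ?B) - ?U)) + weight t (?A \<inter> ?B)"
    by (subst weight_Un_disjoint) (auto simp: add.assoc)
  also have "?U \<union> ((?A \<union> ?B) - ?U) = ?A \<union> (?B - ?A)" using sub by auto
  also have "weight t (?A \<union> (?B - ?A)) = weight t ?A + weight t (?B - ?A)"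
    by (rule weight_Un_disjoint) auto
  also have "weight t ?A + weight t (?B - ?A) + weight t (?A \<inter> ?B)
      = weight t ?A + weight t ((?B - ?A) \<union> (?A \<inter> ?B))"
    by (subst weight_Un_disjoint) (auto simp: add.assoc)
  also have "(?B - ?A) \<union> (?A \<inter> ?B) = ?B" by auto
  also have "weight t ?A + weight t ?B \<le> weight t ?A + weight t J"
    by (intro add_left_mono weight_mono maximal_cells_subset)
  finally show ?thesis .
qed

text \<open>
  Take nearly optimal covers \<open>I n\<close> of the sets \<open>S n\<close> with errors adding up to \<open>e\<close>. Strong subadditivity
  shows by induction that the maximal cells of the first \<open>n\<close> covers together weigh at most the content of
  \<open>S n\<close> plus the errors so far: adding the next cover costs the content of \<open>S (n + 1)\<close>, but the content
  of \<open>S n\<close>, which both covers contain, is gained back. The maximal cells of all covers form the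
  required cover of the union.
\<close>

theorem content_UN_incseq:
  assumes "incseq S"
  shows "content t (\<Union>n. S n) = (SUP n. content t (S n))"
proof (rule antisym)
  show "(SUP n. content t (S n)) \<le> content t (\<Union>n. S n)"
    by (intro SUP_least content_mono) auto
  show "content t (\<Union>n. S n) \<le> (SUP n. content t (S n))" (is "_ \<le> ?L")
  proof (rule ennreal_le_epsilon)
    fix e :: real assume fin: "?L < top" and e: "0 < e"
    have fin': "content t (S n) < \<infinity>" for n
      using fin by (metis SUP_lessD UNIV_I infinity_ennreal_def)
    define \<epsilon> where "\<epsilon> n = e * (1/2) ^ Suc n" for n :: nat
    have pos: "0 < \<epsilon> n" for n unfolding \<epsilon>_def using e by simp
    have "\<exists>I. S n \<subseteq> covered I \<and> weight t I \<le> content t (S n) + ennreal (\<epsilon> n)" for n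
      using content_near_cover[OF fin' pos] by metis
    then obtain I where I: "\<And>n. S n \<subseteq> covered (I n)"
      "\<And>n. weight t (I n) \<le> content t (S n) + ennreal (\<epsilon> n)" by metis
    define U where "U n = (\<Union>i\<le>n. I i)" for n
    have U_Suc: "U (Suc n) = U n \<union> I (Suc n)" for n
      unfolding U_def by (simp add: atMost_Suc Un_commute)
    have step: "weight t (maximal_cells (U n)) \<le> content t (S n) + ennreal (\<Sum>i\<le>n. \<epsilon> i)" for n
    proof (induction n)
      case 0
      have "weight t (maximal_cells (U 0)) \<le> weight t (I 0)"
        unfolding U_def using maximal_cells_subset by (intro weight_mono) auto
      then show ?case using I(2)[of 0] by simp
    next
      case (Suc n)
      have "S n \<subseteq> covered (U n) \<inter> covered (I (Suc n))"
        using I(1)[of n] I(1)[of "Suc n"] incseq_SucD[OF assms, of n] covered_mono[of "I n" "U n"]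
        unfolding U_def by auto
      then have "weight t (maximal_cells (U (Suc n))) + content t (S n)
          \<le> weight t (maximal_cells (U n)) + weight t (I (Suc n))"
        unfolding U_Suc
        by (intro order_trans[OF add_left_mono[OF content_mono] weight_maximal_cells_Un])
      also have "\<dots> \<le> (content t (S n) + ennreal (\<Sum>i\<le>n. \<epsilon> i))
          + (content t (S (Suc n)) + ennreal (\<epsilon> (Suc n)))"
        by (intro add_mono Suc.IH I(2))
      also have "\<dots> = (content t (S (Suc n)) + ennreal (\<Sum>i\<le>Suc n. \<epsilon> i)) + content t (S n)"
        using pos by (simp add: ennreal_plus sum_nonneg less_imp_le add_ac)
      finally show ?case
        using fin'[of n, THEN less_imp_neq] ennreal_add_left_cancel_le[of "content t (S n)"] by (simp add: add.commute)
    qed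
    define J where "J = maximal_cells (\<Union>n. I n)"
    have "(\<Union>n. S n) \<subseteq> covered J"
      unfolding J_def covered_maximal_cells using I(1) unfolding covered_def by blast
    then have "content t (\<Union>n. S n) \<le> weight t J" by (rule content_le)
    also have "J = (\<Union>n. J \<inter> U n)"
      using maximal_cells_subset unfolding J_def U_def by blast
    also have "weight t \<dots> = (SUP n. weight t (J \<inter> U n))"
      unfolding incseq_def U_def by (intro weight_UN_incseq monoI Int_mono UN_mono) auto
    also have "\<dots> \<le> ?L + ennreal e"
    proof (rule SUP_least)
      fix n
      have "weight t (J \<inter> U n) \<le> weight t (maximal_cells (U n))"
        unfolding J_def U_def by (intro weight_mono maximal_cells_antimono) auto
      also have "\<dots> \<le> content t (S n) + ennreal (\<Sum>i\<le>n. \<epsilon> i)" by (rule step)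
      also have "\<dots> \<le> ?L + ennreal e"
      proof (intro add_mono SUP_upper ennreal_leI)
        have "(\<Sum>i\<le>n. \<epsilon> i) \<le> (\<Sum>i. \<epsilon> i)"
          using power_half_series pos unfolding \<epsilon>_def
          by (intro sum_le_suminf summable_mult) (auto simp: sums_iff less_imp_le e)
        also have "\<dots> = e"
          using sums_mult[OF power_half_series, of e] unfolding \<epsilon>_def by (simp add: sums_iff)
        finally show "(\<Sum>i\<le>n. \<epsilon> i) \<le> e" .
      qed simp
      finally show "weight t (J \<inter> U n) \<le> ?L + ennreal e" .
    qed
    finally show "content t (\<Union>n. S n) \<le> ?L + ennreal e" .
  qed
qed

end


section \<open>The torus: topology and dyadic cells\<close>

lemma torus_proj_rep [simp]: "torus_proj (rep_torus z) = z"
  by (rule Quotient3_abs_rep[OF Quotient3_torus])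

lemma torus_rel_rep: "torus_rel (rep_torus (torus_proj v)) v"
  by (simp flip: torus_proj_eq_iff)

lemma dist_torus_proj_le: "dist (torus_proj u) (torus_proj v) \<le> dist u v"
  by (simp add: dist_torus_def torus_dist_le)

text \<open>
  The quotient metric is attained with any prescribed lift of one of the points; this
  transfers estimates from the Euclidean space.
\<close>

lemma torus_near_lift:
  obtains v where "torus_proj v = z" "dist (torus_proj u) z = dist u v"
  using torus_dist_attained[OF refl, where u = u and y = z] by (metis dist_torus_def)

lemma torus_proj_add: "torus_proj (u + v) = torus_proj u + torus_proj v"
  by (simp add: plus_torus.abs_eq)

lemma torus_proj_diff: "torus_proj (u - v) = torus_proj u - torus_proj v"
  by (simp add: minus_torus.abs_eq)

lemma torus_proj_minus: "torus_proj (- v) = - torus_proj v"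
  by (simp add: uminus_torus.abs_eq)

lemma dist_torus_add_le:
  fixes a :: "'n::finite torus"
  shows "dist (a + b) (a' + b') \<le> dist a a' + dist b b'"
proof -
  obtain v where v: "torus_proj v = a'" "dist a a' = dist (rep_torus a) v"
    using torus_near_lift[of a' "rep_torus a"] by auto
  obtain w where w: "torus_proj w = b'" "dist b b' = dist (rep_torus b) w"
    using torus_near_lift[of b' "rep_torus b"] by auto
  have "dist (torus_proj (rep_torus a + rep_torus b)) (torus_proj (v + w))
      \<le> dist (rep_torus a + rep_torus b) (v + w)"
    by (rule dist_torus_proj_le)
  also have "\<dots> \<le> dist (rep_torus a) v + dist (rep_torus b) w"
    by (rule dist_triangle_add)
  finally show ?thesis using v w by (simp add: torus_proj_add)
qed

lemma dist_torus_minus_le: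
  fixes a :: "'n::finite torus"
  shows "dist (- a) (- b) \<le> dist a b"
proof -
  obtain v where v: "torus_proj v = b" "dist a b = dist (rep_torus a) v"
    using torus_near_lift[of b "rep_torus a"] by auto
  have "dist (torus_proj (- rep_torus a)) (torus_proj (- v)) \<le> dist (- rep_torus a) (- v)"
    by (rule dist_torus_proj_le)
  then show ?thesis using v by (simp add: torus_proj_minus dist_minus)
qed

instance torus :: (finite) topological_group_add
proof
  fix a b :: "'a torus"
  show "((\<lambda>x. fst x + snd x) \<longlongrightarrow> a + b) (nhds a \<times>\<^sub>F nhds b)"
  proof (rule metric_tendsto_imp_tendsto[where f = "\<lambda>x. dist (fst x) a + dist (snd x) b" and a = 0])
    have "((\<lambda>x. dist (fst x) a + dist (snd x) b) \<longlongrightarrow> dist a a + dist b b) (nhds a \<times>\<^sub>F nhds b)"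
      by (intro tendsto_intros filterlim_fst filterlim_snd)
    then show "((\<lambda>x. dist (fst x) a + dist (snd x) b) \<longlongrightarrow> 0) (nhds a \<times>\<^sub>F nhds b)" by simp
    show "\<forall>\<^sub>F x in nhds a \<times>\<^sub>F nhds b.
        dist (fst x + snd x) (a + b) \<le> dist (dist (fst x) a + dist (snd x) b) 0"
      by (intro always_eventually allI) (simp add: dist_real_def dist_torus_add_le)
  qed
  show "(uminus \<longlongrightarrow> - a) (nhds a)"
  proof (rule metric_tendsto_imp_tendsto[where f = "\<lambda>x. x" and a = a])
    show "((\<lambda>x. x) \<longlongrightarrow> a) (nhds a)" by (rule filterlim_ident)
    show "\<forall>\<^sub>F x in nhds a. dist (- x) (- a) \<le> dist x a"
      by (intro always_eventually allI dist_torus_minus_le)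
  qed
qed

text \<open>
  The covering map is open, so it carries a countable basis to a countable basis.
\<close>

lemma open_torus_proj_image:
  assumes "open U"
  shows "open (torus_proj ` U)"
  unfolding open_dist
proof
  fix z assume "z \<in> torus_proj ` U"
  then obtain u where u: "u \<in> U" "z = torus_proj u" by blast
  obtain e where e: "e > 0" "\<And>v. dist v u < e \<Longrightarrow> v \<in> U"
    using assms u unfolding open_dist by blast
  have "z' \<in> torus_proj ` U" if near: "dist z' z < e" for z'
  proof -
    obtain v where "torus_proj v = z'" "dist (torus_proj u) z' = dist u v"
      by (rule torus_near_lift)
    then show ?thesis using near u e(2)[of v] by (auto simp: dist_commute)
  qed
  then show "\<exists>e>0. \<forall>z'. dist z' z < e \<longrightarrow> z' \<in> torus_proj ` U" using e by blast
qed

lemma open_torus_proj_vimage: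
  fixes V :: "'n::finite torus set"
  shows "open V \<Longrightarrow> open (torus_proj -` V)"
  using continuous_on_torus_proj[of "UNIV :: (real^'n) set"] by (simp add: continuous_on_open_vimage)

instance torus :: (finite) second_countable_topology
proof
  obtain B :: "(real^'a) set set" where B: "countable B" "topological_basis B"
    using ex_countable_basis by blast
  have "topological_basis ((`) torus_proj ` B)"
  proof (rule topological_basisI)
    fix V assume "V \<in> (`) torus_proj ` B"
    then show "open V" using B(2) by (auto intro: open_torus_proj_image topological_basis_open)
  next
    fix V :: "'a torus set" and z assume V: "open V" "z \<in> V"
    then obtain U where "U \<in> B" "rep_torus z \<in> U" "U \<subseteq> torus_proj -` V"
      using topological_basisE[OF B(2) open_torus_proj_vimage[OF V(1)], of "rep_torus z"] by auto
    then show "\<exists>U'\<in>(`) torus_proj ` B. z \<in> U' \<and> U' \<subseteq> V"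
      by (intro bexI[of _ "torus_proj ` U"]) (auto intro: image_eqI[of _ _ "rep_torus z"])
  qed
  then have "open = generate_topology ((`) torus_proj ` B)"
    by (rule topological_basis_imp_subbasis)
  then show "\<exists>B::'a torus set set. countable B \<and> open = generate_topology B"
    using B(1) by blast
qed

lemma compact_UNIV_torus: "compact (UNIV :: 'n::finite torus set)"
proof -
  let ?K = "cbox (\<chi> i. - 1/2) (\<chi> i. 1/2) :: (real^'n) set"
  have "torus_cube \<subseteq> ?K" by (auto simp: torus_cube_def mem_box_cart less_imp_le)
  then have "UNIV = torus_proj ` ?K"
    using bij_betw_torus_proj unfolding bij_betw_def by blast
  then show ?thesis
    using compact_continuous_image[OF continuous_on_torus_proj compact_cbox] by metis
qed

text \<open>
  The integer parts of the coordinates of \<open>2^k u\<close>, where \<open>u\<close> is a lift of \<open>z\<close>. Reducing them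
  modulo \<open>2^k\<close> makes them independent of the lift (\<open>torus_code_proj\<close>), so that each estimate can use
  the lift that suits it.
\<close>

definition torus_code :: "nat \<Rightarrow> 'n::finite torus \<Rightarrow> int^'n" where
  "torus_code k z = (\<chi> i. \<lfloor>2 ^ k * rep_torus z $ i\<rfloor> mod 2 ^ k)"

lemma floor_shift: "\<lfloor>2 ^ k * (x + real_of_int m)\<rfloor> = \<lfloor>2 ^ k * x\<rfloor> + 2 ^ k * m"
proof -
  have "2 ^ k * (x + real_of_int m) = 2 ^ k * x + real_of_int (2 ^ k * m)"
    by (simp add: algebra_simps)
  then show ?thesis by (simp only: floor_add_int)
qed

lemma torus_code_proj: "torus_code k (torus_proj v) = (\<chi> i. \<lfloor>2 ^ k * v $ i\<rfloor> mod 2 ^ k)"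
  unfolding torus_code_def vec_eq_iff
proof (intro allI)
  fix i
  obtain m where "rep_torus (torus_proj v) $ i - v $ i = real_of_int m"
    using torus_rel_rep[of v] unfolding torus_rel_def by (meson Ints_cases)
  then have "rep_torus (torus_proj v) $ i = v $ i + real_of_int m" by simp
  then show "(\<chi> i. \<lfloor>2 ^ k * rep_torus (torus_proj v) $ i\<rfloor> mod 2 ^ k) $ i
      = (\<chi> i. \<lfloor>2 ^ k * v $ i\<rfloor> mod 2 ^ k) $ i"
    by (simp add: floor_shift)
qed

lemma floor_pow_div:
  fixes x :: real
  assumes "l \<le> k"
  shows "\<lfloor>2 ^ l * x\<rfloor> = \<lfloor>2 ^ k * x\<rfloor> div 2 ^ (k - l)"
proof -
  have "2 ^ l * x = (2 ^ k * x) / real_of_int (2 ^ (k - l))"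
    using power_add[of "2::real" l "k - l"] assms by simp
  then show ?thesis by (simp only: floor_divide_real_eq_div zero_le_power zero_le_numeral)
qed

lemma torus_code_nested:
  assumes "l \<le> k" "torus_code k z = torus_code k z'"
  shows "torus_code l z = torus_code l z'"
  unfolding torus_code_def vec_eq_iff
proof (intro allI)
  fix i
  let ?a = "\<lfloor>2 ^ k * rep_torus z $ i\<rfloor>" and ?b = "\<lfloor>2 ^ k * rep_torus z' $ i\<rfloor>"
  have "?a mod 2 ^ k = ?b mod 2 ^ k"
    using assms(2) by (simp add: torus_code_def vec_eq_iff)
  then obtain m where "?a = ?b + 2 ^ k * m"
    by (metis mod_eqE)
  then have "?a = ?b + 2 ^ (k - l) * (2 ^ l * m)"
    using assms(1) by (simp flip: mult.assoc power_add)
  then have "?a div 2 ^ (k - l) = ?b div 2 ^ (k - l) + 2 ^ l * m"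
    by simp
  then show "(\<chi> i. \<lfloor>2 ^ l * rep_torus z $ i\<rfloor> mod 2 ^ l) $ i
      = (\<chi> i. \<lfloor>2 ^ l * rep_torus z' $ i\<rfloor> mod 2 ^ l) $ i"
    using floor_pow_div[OF assms(1)] by simp
qed

interpretation torus: nested_partitions torus_code
  by standard (rule torus_code_nested)

definition offsets :: "(int^'n::finite) set" where
  "offsets = {e. \<forall>i. e $ i \<in> {-1..1}}"

text \<open>
  The cell itself and the adjacent cells of the same level. Their number is at most the number of
  offsets, which depends on the dimension alone.
\<close>

definition neighbours :: "nat \<Rightarrow> int^'n::finite \<Rightarrow> (int^'n) set" where
  "neighbours k c = (\<lambda>e. \<chi> i. (c $ i + e $ i) mod 2 ^ k) ` offsets"

lemma finite_offsets: "finite (offsets :: (int^'n::finite) set)"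
proof -
  have "(offsets :: (int^'n) set) \<subseteq> (\<lambda>f. \<chi> i. f i) ` (UNIV \<rightarrow>\<^sub>E {-1..1::int})"
  proof
    fix e :: "int^'n" assume "e \<in> offsets"
    then have "e = (\<chi> i. e $ i)" "(\<lambda>i. e $ i) \<in> UNIV \<rightarrow>\<^sub>E {-1..1}"
      by (auto simp: offsets_def PiE_def)
    then show "e \<in> (\<lambda>f. \<chi> i. f i) ` (UNIV \<rightarrow>\<^sub>E {-1..1::int})" by blast
  qed
  then show ?thesis by (rule finite_subset) (intro finite_imageI finite_PiE, auto)
qed

lemma finite_neighbours: "finite (neighbours k c)"
  unfolding neighbours_def by (intro finite_imageI finite_offsets)

lemma card_neighbours_le: "card (neighbours k (c :: int^'n::finite)) \<le> card (offsets :: (int^'n) set)"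
  unfolding neighbours_def by (intro card_image_le finite_offsets)

lemma torus_code_near:
  assumes "dist z z0 \<le> (1/2) ^ k"
  shows "torus_code k z \<in> neighbours k (torus_code k z0)"
proof -
  obtain u where u: "torus_proj u = z0" using torus_proj_surj by blast
  obtain v where v: "torus_proj v = z" "dist z0 z = dist u v"
    using torus_near_lift[of z u] u by auto
  define e where "e = (\<chi> i. \<lfloor>2 ^ k * v $ i\<rfloor> - \<lfloor>2 ^ k * u $ i\<rfloor>)"
  have "e $ i \<in> {-1..1}" for i
  proof -
    have "\<bar>v $ i - u $ i\<bar> \<le> (1/2) ^ k"
      using component_le_norm_cart[of "v - u" i] assms v(2)
      by (simp add: dist_norm dist_commute[of z] norm_minus_commute[of u])
    then have "2 ^ k * \<bar>v $ i - u $ i\<bar> \<le> 2 ^ k * (1/2) ^ k"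
      by (intro mult_left_mono) auto
    then have "\<bar>2 ^ k * v $ i - 2 ^ k * u $ i\<bar> \<le> 1"
      by (simp add: abs_mult power_divide flip: right_diff_distrib)
    then show ?thesis unfolding e_def by simp linarith
  qed
  then have "e \<in> offsets" by (simp add: offsets_def)
  moreover have "torus_code k z = (\<chi> i. (torus_code k z0 $ i + e $ i) mod 2 ^ k)"
    unfolding u[symmetric] v(1)[symmetric] torus_code_proj e_def
    by (simp add: vec_eq_iff mod_simps)
  ultimately show ?thesis unfolding neighbours_def by blast
qed

lemma mod_diff_correction:
  fixes a b c n :: int
  shows "(a mod n - b mod n + (c - (a - b))) mod n = c mod n"
proof -
  have "(a mod n - b mod n + (c - (a - b))) mod n = ((a - b) + (c - (a - b))) mod n"
    by (metis mod_add_left_eq mod_diff_eq)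
  then show ?thesis by simp
qed

lemma torus_code_diff: "torus_code k (z' - z) \<in> neighbours k (torus_code k z' - torus_code k z)"
proof -
  obtain u where u: "torus_proj u = z" using torus_proj_surj by blast
  obtain v where v: "torus_proj v = z'" using torus_proj_surj by blast
  define e where "e = (\<chi> i. \<lfloor>2 ^ k * (v - u) $ i\<rfloor> - (\<lfloor>2 ^ k * v $ i\<rfloor> - \<lfloor>2 ^ k * u $ i\<rfloor>))"
  have "e $ i \<in> {-1..1}" for i
    unfolding e_def by (simp add: right_diff_distrib) linarith
  then have "e \<in> offsets" by (simp add: offsets_def)
  moreover have "torus_code k (z' - z)
      = (\<chi> i. ((torus_code k z' - torus_code k z) $ i + e $ i) mod 2 ^ k)"
    unfolding u[symmetric] v[symmetric] torus_proj_diff[symmetric] torus_code_proj e_def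
    by (simp add: vec_eq_iff mod_diff_correction)
  ultimately show ?thesis unfolding neighbours_def by blast
qed

lemma dist_same_code:
  fixes z :: "'n::finite torus"
  assumes "torus_code k z = torus_code k z'"
  shows "dist z z' \<le> real CARD('n) * (1/2) ^ k"
proof -
  let ?u = "rep_torus z" and ?v = "rep_torus z'"
  have "\<exists>m. \<lfloor>2 ^ k * ?u $ i\<rfloor> = \<lfloor>2 ^ k * ?v $ i\<rfloor> + 2 ^ k * m" for i
    using assms by (simp add: torus_code_def vec_eq_iff) (metis mod_eqE)
  then obtain m where m: "\<And>i. \<lfloor>2 ^ k * ?u $ i\<rfloor> = \<lfloor>2 ^ k * ?v $ i\<rfloor> + 2 ^ k * m i" by metis
  define w where "w = (\<chi> i. ?v $ i + real_of_int (m i))"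
  have "torus_proj w = torus_proj ?v"
    unfolding torus_proj_eq_iff torus_rel_def w_def by simp
  then have w: "torus_proj w = z'" by simp
  have "\<bar>(?u - w) $ i\<bar> \<le> (1/2) ^ k" for i
  proof -
    have "\<lfloor>2 ^ k * ?u $ i\<rfloor> = \<lfloor>2 ^ k * w $ i\<rfloor>" unfolding w_def by (simp add: m floor_shift)
    then have "\<bar>2 ^ k * ?u $ i - 2 ^ k * w $ i\<bar> \<le> 1" by linarith
    then have "2 ^ k * \<bar>(?u - w) $ i\<bar> \<le> 1" by (simp add: abs_mult flip: right_diff_distrib)
    then show ?thesis by (simp add: power_divide field_simps)
  qed
  then have "(\<Sum>i\<in>UNIV. \<bar>(?u - w) $ i\<bar>) \<le> (\<Sum>i\<in>(UNIV::'n set). (1/2) ^ k)"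
    by (intro sum_mono) auto
  then have "norm (?u - w) \<le> real CARD('n) * (1/2) ^ k"
    using norm_le_l1_cart[of "?u - w"] by simp
  then show ?thesis
    using dist_torus_proj_le[of ?u w] w by (simp add: dist_norm)
qed

text \<open>
  Dyadic cells are not open, which is an obstacle to compactness arguments. The interior of the union of
  the neighbours is open and contains the cell, at the cost of a constant factor.
\<close>

definition enlarged_cell :: "nat \<times> (int^'n::finite) \<Rightarrow> 'n torus set" where
  "enlarged_cell q = interior {z. torus_code (fst q) z \<in> neighbours (fst q) (snd q)}"

lemma open_enlarged_cell: "open (enlarged_cell q)"
  unfolding enlarged_cell_def by simp

lemma mem_enlarged_cell: "z \<in> enlarged_cell (k, torus_code k z)"
proof -
  have "ball z ((1/2) ^ k) \<subseteq> {z'. torus_code k z' \<in> neighbours k (torus_code k z)}"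
    by (auto intro!: torus_code_near simp: dist_commute less_imp_le)
  then show ?thesis unfolding enlarged_cell_def
    by (auto simp: mem_interior intro!: exI[of _ "(1/2) ^ k"])
qed

lemma enlarged_cell_subset: "z \<in> enlarged_cell (k, c) \<Longrightarrow> torus_code k z \<in> neighbours k c"
  using interior_subset unfolding enlarged_cell_def by auto


section \<open>Lebesgue measure on the torus\<close>

lemma sets_torus_lebesgue [simp, measurable_cong]: "sets torus_lebesgue = sets borel"
  by (simp add: torus_lebesgue_def)

lemma space_torus_lebesgue [simp]: "space torus_lebesgue = UNIV"
  by (simp add: torus_lebesgue_def)

lemma borel_measurable_torus_proj [measurable]: "torus_proj \<in> borel_measurable borel"
  by (rule borel_measurable_continuous_onI[OF continuous_on_torus_proj])

lemma emeasure_torus_lebesgue: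
  fixes B :: "'n::finite torus set"
  assumes "B \<in> sets borel"
  shows "emeasure torus_lebesgue B = emeasure lborel {u \<in> torus_cube. torus_proj u \<in> B}"
proof -
  have "torus_proj \<in> restrict_space lborel (torus_cube :: (real^'n) set) \<rightarrow>\<^sub>M borel"
    by (intro measurable_restrict_space1) simp
  then have "emeasure torus_lebesgue B
      = emeasure (restrict_space lborel (torus_cube :: (real^'n) set)) (torus_proj -` B \<inter> torus_cube)"
    unfolding torus_lebesgue_def using assms
    by (simp add: emeasure_distr space_restrict_space)
  also have "\<dots> = emeasure lborel (torus_proj -` B \<inter> torus_cube)"
    by (intro emeasure_restrict_space) (auto simp: torus_cube_borel)
  also have "torus_proj -` B \<inter> torus_cube = {u \<in> torus_cube. torus_proj u \<in> B}" by auto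
  finally show ?thesis .
qed

definition lattice_point :: "int^'n::finite \<Rightarrow> real^'n" where
  "lattice_point m = (\<chi> i. real_of_int (m $ i))"

lemma torus_proj_add_lattice [simp]: "torus_proj (u + lattice_point m) = torus_proj u"
  by (simp add: torus_proj_eq_iff torus_rel_def lattice_point_def)

lemma torus_cube_tiles: "\<exists>!m. u - lattice_point m \<in> torus_cube"
proof (rule ex1I[of _ "\<chi> i. \<lfloor>u $ i + 1/2\<rfloor>"])
  show "u - lattice_point (\<chi> i. \<lfloor>u $ i + 1/2\<rfloor>) \<in> torus_cube"
    unfolding torus_cube_def lattice_point_def by (auto; linarith)
next
  fix m assume m: "u - lattice_point m \<in> torus_cube"
  show "m = (\<chi> i. \<lfloor>u $ i + 1/2\<rfloor>)"
    unfolding vec_eq_iff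
  proof
    fix i
    have "- 1/2 \<le> u $ i - m $ i" "u $ i - m $ i < 1/2"
      using m unfolding torus_cube_def lattice_point_def by auto
    then show "m $ i = (\<chi> i. \<lfloor>u $ i + 1/2\<rfloor>) $ i" by (simp add: eq_commute[of "m $ i"] floor_eq_iff)
  qed
qed

lemma torus_cube_tiles': "\<exists>!m. u + lattice_point m \<in> torus_cube"
proof -
  have neg: "lattice_point (- m) = - lattice_point m" for m :: "int^'n::finite"
    by (simp add: lattice_point_def vec_eq_iff)
  obtain m where m: "u - lattice_point m \<in> torus_cube"
    "\<And>m'. u - lattice_point m' \<in> torus_cube \<Longrightarrow> m' = m"
    using torus_cube_tiles[of u] by blast
  show ?thesis
  proof (rule ex1I[of _ "- m"])
    show "u + lattice_point (- m) \<in> torus_cube" using m(1) by (simp add: neg)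
    show "m' = - m" if "u + lattice_point m' \<in> torus_cube" for m'
      using m(2)[of "- m'"] that by (auto simp: neg)
  qed
qed

lemma emeasure_lborel_shift:
  fixes S :: "'a::euclidean_space set"
  assumes "S \<in> sets borel"
  shows "emeasure lborel {u. w + u \<in> S} = emeasure lborel S"
proof -
  have "emeasure lborel S = emeasure (distr lborel borel ((+) w)) S"
    by (simp add: lborel_distr_plus)
  also have "\<dots> = emeasure lborel {u. w + u \<in> S}"
    using assms by (subst emeasure_distr) (auto simp: vimage_def)
  finally show ?thesis by simp
qed

lemma emeasure_lborel_split:
  fixes S :: "'a::euclidean_space set" and T :: "'b::countable \<Rightarrow> 'a set"
  assumes S: "S \<in> sets borel" and T: "\<And>m. T m \<in> sets borel" and part: "\<And>u. \<exists>!m. u \<in> T m"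
  shows "emeasure lborel S = (\<integral>\<^sup>+m. emeasure lborel (S \<inter> T m) \<partial>count_space UNIV)"
proof -
  have "S = (\<Union>m. S \<inter> T m)" using part by blast
  then have "emeasure lborel S = emeasure lborel (\<Union>m. S \<inter> T m)" by simp
  also have "\<dots> = (\<integral>\<^sup>+m. emeasure lborel (S \<inter> T m) \<partial>count_space UNIV)"
    using S T part by (intro emeasure_UN_countable) (auto simp: disjoint_family_on_def)
  finally show ?thesis .
qed

text \<open>
  The cube and its translate by a lift of \<open>a\<close> are two fundamental domains of the integer lattice.
  Cutting one of them along the tiles of the other and moving the pieces by lattice vectors
  shows that a periodic set has the same measure in both.
\<close>

lemma emeasure_torus_lebesgue_translate:
  fixes B :: "'n::finite torus set"
  assumes B: "B \<in> sets borel"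
  shows "emeasure torus_lebesgue {z. z + a \<in> B} = emeasure torus_lebesgue B"
proof -
  obtain v where v: "torus_proj v = a" using torus_proj_surj by blast
  define D where "D = {u. torus_proj u \<in> B}"
  have shift_borel: "{u. w + u \<in> S} \<in> sets borel" if "S \<in> sets borel" for w :: "real^'n" and S
    using that by measurable
  have D: "D \<in> sets borel" unfolding D_def using B by measurable
  have cube: "{u. w + u \<in> (torus_cube :: (real^'n) set)} \<in> sets borel" for w
    by (rule shift_borel[OF torus_cube_borel])
  have Dm: "u + lattice_point m \<in> D \<longleftrightarrow> u \<in> D" for u m
    unfolding D_def by simp
  let ?V = "{u. - v + u \<in> torus_cube} \<inter> D"
  have "{z. z + a \<in> B} \<in> sets borel" using B by measurable
  then have "emeasure torus_lebesgue {z. z + a \<in> B} = emeasure lborel {u \<in> torus_cube. torus_proj u + a \<in> B}"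
    by (simp add: emeasure_torus_lebesgue)
  also have "{u \<in> torus_cube. torus_proj u + a \<in> B} = {u. v + u \<in> ?V}"
    by (auto simp: D_def torus_proj_add v add.commute)
  also have "emeasure lborel \<dots> = emeasure lborel ?V"
    by (intro emeasure_lborel_shift sets.Int cube D)
  also have "\<dots> = (\<integral>\<^sup>+m. emeasure lborel (?V \<inter> {u. - lattice_point m + u \<in> torus_cube}) \<partial>count_space UNIV)"
  proof (intro emeasure_lborel_split sets.Int cube D)
    show "\<exists>!m. u \<in> {u. - lattice_point m + u \<in> torus_cube}" for u
      using torus_cube_tiles[of u] by (simp add: algebra_simps)
  qed
  also have "\<dots> = (\<integral>\<^sup>+m. emeasure lborel ((torus_cube \<inter> D) \<inter> {u. (lattice_point m - v) + u \<in> torus_cube}) \<partial>count_space UNIV)"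
  proof (intro nn_integral_cong)
    fix m
    have "emeasure lborel (?V \<inter> {u. - lattice_point m + u \<in> torus_cube})
      = emeasure lborel {u. lattice_point m + u \<in> ?V \<inter> {u. - lattice_point m + u \<in> torus_cube}}"
      by (intro emeasure_lborel_shift[symmetric] sets.Int cube D)
    also have "{u. lattice_point m + u \<in> ?V \<inter> {u. - lattice_point m + u \<in> torus_cube}}
        = (torus_cube \<inter> D) \<inter> {u. (lattice_point m - v) + u \<in> torus_cube}"
      using Dm[of _ m] by (auto simp: algebra_simps)
    finally show "emeasure lborel (?V \<inter> {u. - lattice_point m + u \<in> torus_cube})
      = emeasure lborel ((torus_cube \<inter> D) \<inter> {u. (lattice_point m - v) + u \<in> torus_cube})" .
  qed
  also have "\<dots> = emeasure lborel (torus_cube \<inter> D)"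
  proof (rule emeasure_lborel_split[symmetric])
    show "\<exists>!m. u \<in> {u. (lattice_point m - v) + u \<in> torus_cube}" for u
      using torus_cube_tiles'[of "u - v"] by (simp add: algebra_simps)
  qed (use D cube torus_cube_borel in auto)
  also have "torus_cube \<inter> D = {u \<in> torus_cube. torus_proj u \<in> B}"
    by (auto simp: D_def)
  also have "emeasure lborel \<dots> = emeasure torus_lebesgue B"
    using B by (simp add: emeasure_torus_lebesgue)
  finally show ?thesis .
qed

interpretation torus_lebesgue: prob_space "torus_lebesgue :: 'n::finite torus measure"
  by (rule prob_space_torus_lebesgue)

interpretation torus_product: product_prob_space "\<lambda>_::nat. torus_lebesgue :: 'n::finite torus measure" UNIV
  by unfold_locales

lemma distr_product_translate:
  fixes a :: "'n::finite torus"
  defines "P \<equiv> PiM (UNIV :: nat set) (\<lambda>_. torus_lebesgue :: 'n torus measure)"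
  shows "distr P P (\<lambda>x n. x n + a) = P"
  unfolding P_def
proof (rule torus_product.PiM_eq)
  show "sets (distr (Pi\<^sub>M UNIV (\<lambda>_. torus_lebesgue)) (Pi\<^sub>M UNIV (\<lambda>_. torus_lebesgue)) (\<lambda>x n. x n + a))
     = sets (Pi\<^sub>M UNIV (\<lambda>_. torus_lebesgue))" by simp
next
  fix J :: "nat set" and F :: "nat \<Rightarrow> 'n torus set"
  assume J: "finite J" and "J \<subseteq> UNIV" and F: "\<And>j. j \<in> J \<Longrightarrow> F j \<in> sets torus_lebesgue"
  let ?P = "Pi\<^sub>M (UNIV :: nat set) (\<lambda>_. torus_lebesgue :: 'n torus measure)"
  let ?G = "\<lambda>j. {z. z + a \<in> F j}"
  have G: "?G j \<in> sets torus_lebesgue" if "j \<in> J" for j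
    using F[OF that] by simp measurable
  have meas: "(\<lambda>x n. x n + a) \<in> ?P \<rightarrow>\<^sub>M ?P"
    by (rule measurable_PiM_single') (auto simp: space_PiM)
  have emb: "prod_emb UNIV (\<lambda>_. torus_lebesgue) J (Pi\<^sub>E J H) = {x. \<forall>j\<in>J. x j \<in> H j}"
    for H :: "nat \<Rightarrow> 'n torus set"
    by (auto simp: prod_emb_def PiE_def Pi_def)
  have "emeasure (distr ?P ?P (\<lambda>x n. x n + a)) (prod_emb UNIV (\<lambda>_. torus_lebesgue) J (Pi\<^sub>E J F))
      = emeasure ?P ((\<lambda>x n. x n + a) -` prod_emb UNIV (\<lambda>_. torus_lebesgue) J (Pi\<^sub>E J F) \<inter> space ?P)"
    using meas J F by (intro emeasure_distr sets_PiM_I) auto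
  also have "(\<lambda>x n. x n + a) -` prod_emb UNIV (\<lambda>_. torus_lebesgue) J (Pi\<^sub>E J F) \<inter> space ?P
      = prod_emb UNIV (\<lambda>_. torus_lebesgue) J (Pi\<^sub>E J ?G)"
    unfolding emb by (auto simp: space_PiM)
  also have "emeasure ?P \<dots> = (\<Prod>j\<in>J. emeasure torus_lebesgue (?G j))"
    using J G by (intro torus_product.emeasure_PiM_emb) auto
  also have "\<dots> = (\<Prod>j\<in>J. emeasure torus_lebesgue (F j))"
    using F by (intro prod.cong refl emeasure_torus_lebesgue_translate) simp
  finally show "emeasure (distr ?P ?P (\<lambda>x n. x n + a)) (prod_emb UNIV (\<lambda>_. torus_lebesgue) J (Pi\<^sub>E J F))
      = (\<Prod>j\<in>J. emeasure torus_lebesgue (F j))" .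
qed

lemma sets_torus_product: "sets (PiM (UNIV :: nat set) (\<lambda>_. torus_lebesgue :: 'n::finite torus measure)) = sets borel"
proof -
  have "sets (PiM (UNIV :: nat set) (\<lambda>_. torus_lebesgue :: 'n torus measure))
      = sets (PiM (UNIV :: nat set) (\<lambda>_. borel :: 'n torus measure))"
    by (intro sets_PiM_cong) auto
  then show ?thesis by (simp add: sets_PiM_equal_borel)
qed

text \<open>
  Since the product measure is invariant under the diagonal translations, the measure of \<open>N\<close> is the
  average over \<open>a\<close> of the measures of its translates. By Fubini's theorem this is the average over \<open>x\<close> of the
  probability that the translate of \<open>x\<close> by \<open>a\<close> is in \<open>N\<close>.
\<close>

lemma null_if_translates_null:
  fixes N :: "(nat \<Rightarrow> 'n::finite torus) set"
  defines "P \<equiv> PiM UNIV (\<lambda>_. torus_lebesgue :: 'n torus measure)"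
  assumes N: "N \<in> sets borel"
    and null: "AE x in P. AE a in torus_lebesgue. (\<lambda>n. x n + a) \<notin> N"
  shows "emeasure P N = 0"
proof -
  interpret Q: prob_space P unfolding P_def by (rule torus_product.prob_space_axioms)
  interpret pair_prob_space P "torus_lebesgue :: 'n torus measure" ..
  have NP: "N \<in> sets P" using N unfolding P_def by (simp add: sets_torus_product)
  have shift: "(\<lambda>p n. fst p n + snd p) \<in> P \<Otimes>\<^sub>M torus_lebesgue \<rightarrow>\<^sub>M P"
    unfolding P_def by (rule measurable_PiM_single') (auto simp: space_PiM)
  have ind: "(\<lambda>(x, a). indicator N (\<lambda>n. x n + a) :: ennreal) \<in> borel_measurable (P \<Otimes>\<^sub>M torus_lebesgue)"
    using measurable_compose[OF shift borel_measurable_indicator[OF NP]] by (simp add: split_beta')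
  have "emeasure P N = (\<integral>\<^sup>+a. emeasure P N \<partial>(torus_lebesgue :: 'n torus measure))"
    using prob_space.emeasure_space_1[OF prob_space_torus_lebesgue[where ?'n = 'n]] by simp
  also have "\<dots> = (\<integral>\<^sup>+a. (\<integral>\<^sup>+x. indicator N (\<lambda>n. x n + a) \<partial>P) \<partial>torus_lebesgue)"
  proof (intro nn_integral_cong)
    fix a :: "'n torus"
    have m: "(\<lambda>x n. x n + a) \<in> P \<rightarrow>\<^sub>M P"
      unfolding P_def by (rule measurable_PiM_single') (auto simp: space_PiM)
    have "emeasure P N = (\<integral>\<^sup>+x. indicator N x \<partial>(distr P P (\<lambda>x n. x n + a)))"
      using NP distr_product_translate[of a] unfolding P_def by simp
    also have "\<dots> = (\<integral>\<^sup>+x. indicator N (\<lambda>n. x n + a) \<partial>P)"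
      using m NP by (intro nn_integral_distr) auto
    finally show "emeasure P N = (\<integral>\<^sup>+x. indicator N (\<lambda>n. x n + a) \<partial>P)" .
  qed
  also have "\<dots> = (\<integral>\<^sup>+x. (\<integral>\<^sup>+a. indicator N (\<lambda>n. x n + a) \<partial>torus_lebesgue) \<partial>P)"
    using ind by (rule Fubini')
  also have "\<dots> = (\<integral>\<^sup>+x. 0 \<partial>P)"
    using null
  proof (intro nn_integral_cong_AE, eventually_elim)
    fix x assume "AE a in torus_lebesgue. (\<lambda>n. x n + a) \<notin> N"
    then have "AE a in torus_lebesgue. indicator N (\<lambda>n. x n + a) = (0::ennreal)"
      by eventually_elim simp
    then have "(\<integral>\<^sup>+a. indicator N (\<lambda>n. x n + a) \<partial>torus_lebesgue) = (\<integral>\<^sup>+a. 0 \<partial>(torus_lebesgue :: 'n torus measure))"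
      by (rule nn_integral_cong_AE)
    then show "(\<integral>\<^sup>+a. indicator N (\<lambda>n. x n + a) \<partial>torus_lebesgue) = 0" by simp
  qed
  finally show ?thesis by simp
qed

text \<open>
  A cell in the torus may wrap around the boundary of the cube, so its preimage in the cube can consist of several
  boxes. They are indexed by the integer parts of the coordinates, which are again offsets.
\<close>

lemma emeasure_enlarged_cell_le:
  fixes c :: "int^'n::finite"
  shows "emeasure torus_lebesgue (enlarged_cell (k, c))
    \<le> ennreal (real (card (offsets :: (int^'n) set)) ^ 2 * ((1/2) ^ k) ^ CARD('n))"
proof -
  let ?E = "offsets :: (int^'n) set"
  define low where "low q = (\<chi> i. real_of_int (fst q $ i + 2 ^ k * snd q $ i) / 2 ^ k)"
    for q :: "(int^'n) \<times> (int^'n)"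
  define box where "box q = cbox (low q) (low q + (\<chi> i. (1/2) ^ k))" for q
  have vol: "emeasure lborel (box q) = ennreal (((1/2) ^ k) ^ CARD('n))" for q
  proof -
    have ne: "cbox (low q) (low q + (\<chi> i. (1/2) ^ k)) \<noteq> {}"
      by (simp add: interval_ne_empty_cart)
    have "measure lborel (box q) = (\<Prod>i\<in>(UNIV::'n set). (1/2) ^ k)"
      unfolding box_def using content_cbox_cart[OF ne] by simp
    then have m: "measure lborel (box q) = ((1/2) ^ k) ^ CARD('n)"
      by simp
    have "emeasure lborel (box q) = ennreal (measure lborel (box q))"
      unfolding box_def by (intro emeasure_eq_ennreal_measure) (simp add: emeasure_lborel_cbox_eq)
    with m show ?thesis by simp
  qed
  have "{u \<in> torus_cube. torus_proj u \<in> enlarged_cell (k, c)} \<subseteq> (\<Union>q\<in>neighbours k c \<times> ?E. box q)"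
  proof
    fix u assume "u \<in> {u \<in> torus_cube. torus_proj u \<in> enlarged_cell (k, c)}"
    then have u: "u \<in> torus_cube" "torus_code k (torus_proj u) \<in> neighbours k c"
      using enlarged_cell_subset by auto
    define e where "e = (\<chi> i. \<lfloor>u $ i\<rfloor>)"
    have "\<lfloor>u $ i\<rfloor> \<in> {-1..1}" for i
    proof -
      have "- 1/2 \<le> u $ i" "u $ i < 1/2" using u(1) by (auto simp: torus_cube_def)
      then have "- 1 \<le> u $ i" "u $ i < 1" by linarith+
      then show ?thesis by (auto simp: le_floor_iff floor_le_iff)
    qed
    then have e: "e \<in> ?E" by (simp add: offsets_def e_def)
    have "u \<in> box (torus_code k (torus_proj u), e)"
      unfolding box_def mem_box_cart
    proof
      fix i
      have "\<lfloor>2 ^ k * u $ i\<rfloor> mod 2 ^ k + 2 ^ k * \<lfloor>u $ i\<rfloor> = \<lfloor>2 ^ k * u $ i\<rfloor>"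
        using floor_pow_div[of 0 k "u $ i"] by simp
      then have "low (torus_code k (torus_proj u), e) $ i = real_of_int \<lfloor>2 ^ k * u $ i\<rfloor> / 2 ^ k"
        unfolding low_def by (simp add: torus_code_proj e_def del: of_int_add of_int_mult)
      then obtain x :: real where x: "low (torus_code k (torus_proj u), e) $ i = x / 2 ^ k"
        "x \<le> 2 ^ k * u $ i" "2 ^ k * u $ i \<le> x + 1"
        using of_int_floor_le real_of_int_floor_add_one_ge by blast
      from x(2,3) show "low (torus_code k (torus_proj u), e) $ i \<le> u $ i \<and>
          u $ i \<le> (low (torus_code k (torus_proj u), e) + (\<chi> i. (1/2) ^ k)) $ i"
        unfolding vector_add_component x(1) by (simp add: power_divide field_simps)
    qed
    then show "u \<in> (\<Union>q\<in>neighbours k c \<times> ?E. box q)" using e u(2) by blast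
  qed
  then have "emeasure torus_lebesgue (enlarged_cell (k, c))
      \<le> emeasure lborel (\<Union>q\<in>neighbours k c \<times> ?E. box q)"
    using open_enlarged_cell[of "(k, c)"] finite_neighbours finite_offsets
    by (subst emeasure_torus_lebesgue) (auto intro!: emeasure_mono sets.finite_UN simp: box_def)
  also have "\<dots> \<le> (\<Sum>q\<in>neighbours k c \<times> ?E. emeasure lborel (box q))"
    by (intro emeasure_subadditive_finite) (auto simp: box_def finite_neighbours finite_offsets)
  also have "\<dots> = of_nat (card (neighbours k c) * card ?E) * ennreal (((1/2) ^ k) ^ CARD('n))"
    by (simp add: vol card_cartesian_product)
  also have "\<dots> \<le> of_nat (card ?E * card ?E) * ennreal (((1/2) ^ k) ^ CARD('n))"
    by (intro mult_right_mono of_nat_mono mult_le_mono card_neighbours_le) auto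
  also have "\<dots> = ennreal (real (card ?E) ^ 2 * ((1/2) ^ k) ^ CARD('n))"
    by (simp add: ennreal_mult power2_eq_square ennreal_of_nat_eq_real_of_nat)
  finally show ?thesis .
qed


section \<open>Hausdorff and packing measures in terms of dyadic cells\<close>

lemma scale_weight_pair: "scale_weight t (k, c) = ennreal (((1/2) ^ k) powr t)"
  by (simp add: scale_weight_def)

text \<open>
  A family of small total weight can only contain small cells. For \<open>t = 0\<close> the family is empty,
  since every cell has weight \<open>1\<close>.
\<close>

lemma weight_less_deep:
  assumes "weight t I < ennreal (((1/2) ^ K) powr t)" "(k, c) \<in> I" "0 \<le> t"
  shows "K < k"
proof (rule ccontr)
  assume "\<not> K < k"
  then have "((1/2::real) ^ K) powr t \<le> ((1/2) ^ k) powr t"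
    using assms(3) by (intro powr_mono2 power_decreasing) auto
  then have "ennreal (((1/2) ^ K) powr t) \<le> scale_weight t (k, c)"
    by (simp add: scale_weight_pair ennreal_leI)
  also have "\<dots> \<le> weight t I" by (rule scale_weight_le_weight[OF assms(2)])
  finally show False using assms(1) by simp
qed

lemma weight_enumerated:
  fixes e :: "nat \<Rightarrow> nat \<times> 'c"
  assumes "bij e"
  shows "weight t I = (\<Sum>i. scale_weight t (e i) * indicator I (e i))"
proof -
  have "weight t I = (\<integral>\<^sup>+i. scale_weight t (e i) * indicator I (e i) \<partial>count_space UNIV)"
    unfolding weight_eq
    using nn_integral_bij_count_space[OF assms, of "\<lambda>q. scale_weight t q * indicator I q"] by simp
  then show ?thesis by (simp add: nn_integral_count_space_nat)
qed

lemma ex_enumeration: "\<exists>e :: nat \<Rightarrow> nat \<times> ('c::countable). bij e"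
proof -
  have "infinite (UNIV :: (nat \<times> 'c) set)"
    by (simp add: finite_prod)
  then show ?thesis
    using bij_betw_from_nat_into[of "UNIV :: (nat \<times> 'c) set"] by auto
qed

lemma bounded_torus: "bounded (U :: 'n::finite torus set)"
  using compact_imp_bounded[OF compact_UNIV_torus] bounded_subset by blast

text \<open>
  A cover by cells of small weight consists of small cells, so it is a \<open>\<delta>\<close>-cover. The diameter of a
  cell is at most a constant times its side.
\<close>

lemma hausdorff_measure_eq_0:
  fixes S :: "'n::finite torus set"
  assumes null: "torus.content t S = 0" and t: "0 \<le> t"
  shows "hausdorff_measure t S = 0"
proof -
  let ?n = "real CARD('n)"
  obtain e :: "nat \<Rightarrow> nat \<times> (int^'n)" where e: "bij e" using ex_enumeration by blast
  have eps: "hausdorff_premeasure t \<delta> S \<le> 0 + ennreal \<eta>" if \<delta>: "0 < \<delta>" and \<eta>: "0 < \<eta>" for \<delta> \<eta>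
  proof -
    obtain K where K: "(1/2) ^ K < \<delta> / ?n"
      using real_arch_pow_inv[of "\<delta> / ?n" "1/2"] \<delta> by auto
    have n0: "0 < ?n powr t" by simp
    \<comment> \<open>The first bound makes the Hausdorff sum small, the second one the diameters.\<close>
    have "torus.content t S < ennreal (min (\<eta> / ?n powr t) (((1/2) ^ K) powr t))"
      unfolding null using \<eta> n0 by simp
    then obtain I where I: "S \<subseteq> torus.covered I"
      "weight t I < ennreal (min (\<eta> / ?n powr t) (((1/2) ^ K) powr t))"
      by (rule torus.content_less_cover)
    have I2: "weight t I < ennreal (\<eta> / ?n powr t)" "weight t I < ennreal (((1/2) ^ K) powr t)"
      by (rule order.strict_trans2[OF I(2)], rule ennreal_leI, simp)+
    have deep: "K < fst (e i)" if "e i \<in> I" for i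
      using weight_less_deep[of t I K "fst (e i)" "snd (e i)"] I2(2) that t
      by auto
    define U where "U i = (if e i \<in> I then {z. torus_code (fst (e i)) z = snd (e i)} else {})" for i
    have diam: "diameter (U i) \<le> ?n * (1/2) ^ fst (e i)" for i
      unfolding diameter_def by (auto simp: U_def intro!: cSUP_least dist_same_code)
    have "S \<subseteq> (\<Union>i. U i)"
    proof
      fix z assume "z \<in> S"
      then obtain k where k: "(k, torus_code k z) \<in> I"
        using I(1) unfolding torus.covered_def by auto
      obtain i where "e i = (k, torus_code k z)" using e by (metis bij_pointE)
      with k have "z \<in> U i" by (simp add: U_def)
      then show "z \<in> (\<Union>i. U i)" by blast
    qed
    moreover have "diameter (U i) \<le> \<delta>" for i
    proof (cases "e i \<in> I")
      case True
      have "?n * (1/2) ^ fst (e i) \<le> ?n * (1/2) ^ K"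
        using deep[OF True] by (intro mult_left_mono power_decreasing) auto
      also have "\<dots> \<le> \<delta>" using K by (simp add: field_simps)
      finally show ?thesis using diam[of i] by simp
    qed (use \<delta> in \<open>simp add: U_def\<close>)
    ultimately have "hausdorff_premeasure t \<delta> S \<le> (\<Sum>i. diam_powr t (U i))"
      unfolding hausdorff_premeasure_def by (intro INF_lower) (auto simp: bounded_torus)
    also have "\<dots> \<le> (\<Sum>i. ennreal (?n powr t) * (scale_weight t (e i) * indicator I (e i)))"
    proof (intro suminf_le)
      fix i
      show "diam_powr t (U i) \<le> ennreal (?n powr t) * (scale_weight t (e i) * indicator I (e i))"
      proof (cases "U i = {}")
        case False
        then have i: "e i \<in> I" by (auto simp: U_def)
        have "diam_powr t (U i) \<le> ennreal ((?n * (1/2) ^ fst (e i)) powr t)"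
          using False diam[of i] diameter_ge_0[OF bounded_torus, of "U i"] t
          by (auto simp: diam_powr_def intro!: ennreal_leI powr_mono2)
        also have "\<dots> = ennreal (?n powr t) * scale_weight t (e i)"
          by (simp add: scale_weight_def powr_mult ennreal_mult)
        finally show ?thesis using i by simp
      qed (simp add: diam_powr_def)
    qed auto
    also have "\<dots> = ennreal (?n powr t) * weight t I"
      unfolding weight_enumerated[OF e] by simp
    also have "\<dots> \<le> ennreal (?n powr t) * ennreal (\<eta> / ?n powr t)"
      using I2(1) by (intro mult_left_mono) auto
    also have "\<dots> = ennreal \<eta>"
      using n0 \<eta> by (simp flip: ennreal_mult)
    finally show ?thesis by simp
  qed
  have "hausdorff_premeasure t \<delta> S \<le> 0" if "0 < \<delta>" for \<delta>
    by (rule ennreal_le_epsilon) (rule eps[OF that])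
  then show ?thesis
    unfolding hausdorff_measure_def by (intro antisym SUP_least) auto
qed

lemma card_torus_code_image:
  fixes U :: "'n::finite torus set"
  assumes "diameter U \<le> (1/2) ^ k"
  shows "finite (torus_code k ` U)"
    and "card (torus_code k ` U) \<le> card (offsets :: (int^'n) set)"
proof -
  have "finite (torus_code k ` U) \<and> card (torus_code k ` U) \<le> card (offsets :: (int^'n) set)"
  proof (cases "U = {}")
    case False
    then obtain z0 where z0: "z0 \<in> U" by blast
    have "torus_code k ` U \<subseteq> neighbours k (torus_code k z0)"
    proof safe
      fix z assume "z \<in> U"
      then have "dist z z0 \<le> (1/2) ^ k"
        using diameter_bounded_bound[OF bounded_torus _ z0] assms by fastforce
      then show "torus_code k z \<in> neighbours k (torus_code k z0)" by (rule torus_code_near)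
    qed
    then show ?thesis
      using finite_neighbours card_neighbours_le
      by (meson card_mono finite_subset le_trans)
  qed simp
  then show "finite (torus_code k ` U)"
    and "card (torus_code k ` U) \<le> card (offsets :: (int^'n) set)" by auto
qed

text \<open>
  Replaces a diameter by a dyadic side. The error term accounts for sets of diameter zero, which
  contribute nothing to the Hausdorff sum if \<open>s > 0\<close> but have to be put into cells of positive side.
\<close>

lemma dyadic_scale:
  fixes r s \<eta> :: real
  assumes "0 \<le> r" "r \<le> 1" "0 \<le> s" "0 < \<eta>"
  shows "\<exists>k. r \<le> (1/2) ^ k \<and> ((1/2) ^ k) powr s \<le> 2 powr s * (if s = 0 then 1 else r powr s) + \<eta>"
proof (cases "s = 0")
  case True
  then show ?thesis using assms by (intro exI[of _ 0]) auto
next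
  case s: False
  show ?thesis
  proof (cases "r = 0")
    case True
    have "(1/2) powr s < (1::real)" using assms s powr_less_mono2[of s "1/2" 1] by simp
    then obtain k where k: "((1/2::real) powr s) ^ k < \<eta>"
      using real_arch_pow_inv[OF assms(4)] by blast
    have "((1/2::real) ^ k) powr s = ((1/2) powr s) ^ k"
      by (simp add: powr_power powr_powr mult.commute flip: powr_realpow)
    with k show ?thesis using True s by (intro exI[of _ k]) auto
  next
    case False
    then have ex: "\<exists>k. (1/2) ^ k < r" using real_arch_pow_inv[of r "1/2"] assms by auto
    define m where "m = (LEAST k. (1/2) ^ k < r)"
    have m: "(1/2) ^ m < r" unfolding m_def using ex by (rule LeastI_ex)
    then obtain k where k: "m = Suc k" using assms(2) by (cases m) auto
    have "r \<le> (1/2) ^ k"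
      using not_less_Least[of k "\<lambda>k. (1/2) ^ k < r"] k unfolding m_def by auto
    moreover have "((1/2) ^ k) powr s \<le> (2 * r) powr s"
      using m k assms by (intro powr_mono2) auto
    ultimately show ?thesis
      using s assms by (intro exI[of _ k]) (auto simp: powr_mult)
  qed
qed

text \<open>
  A set of diameter at most \<open>2^-k\<close> meets boundedly many cells of level \<open>k\<close>.
\<close>

lemma content_eq_0_if_hausdorff_measure_eq_0:
  fixes E :: "'n::finite torus set"
  assumes null: "hausdorff_measure s E = 0" and s: "0 \<le> s"
  shows "torus.content s E = 0"
proof -
  let ?N = "real (card (offsets :: (int^'n) set))"
  have "hausdorff_premeasure s 1 E \<le> hausdorff_measure s E"
    unfolding hausdorff_measure_def by (intro SUP_upper) simp
  then have null1: "hausdorff_premeasure s 1 E = 0" using null by simp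
  have "torus.content s E \<le> 0 + ennreal \<eta>" if \<eta>: "0 < \<eta>" for \<eta>
  proof -
    \<comment> \<open>Each covering set costs \<open>?N\<close> cells, and rounding its diameter to a dyadic number costs the factor
      \<open>2 powr s\<close> and an error, whose sum is another \<open>\<epsilon>\<close>.\<close>
    define \<epsilon> where "\<epsilon> = \<eta> / ((?N + 1) * (2 powr s + 1))"
    have pos: "0 < (?N + 1) * (2 powr s + 1)"
      by (intro mult_pos_pos add_nonneg_pos) auto
    then have \<epsilon>: "0 < \<epsilon>" unfolding \<epsilon>_def using \<eta> by simp
    have "hausdorff_premeasure s 1 E < ennreal \<epsilon>" using null1 \<epsilon> by simp
    then obtain U :: "nat \<Rightarrow> 'n torus set" where U: "E \<subseteq> (\<Union>j. U j)" "\<And>j. diameter (U j) \<le> 1"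
      "(\<Sum>j. diam_powr s (U j)) < ennreal \<epsilon>"
      unfolding hausdorff_premeasure_def INF_less_iff by auto
    define fits where "fits j k \<longleftrightarrow> U j = {} \<or> (diameter (U j) \<le> (1/2) ^ k \<and>
        ennreal (((1/2) ^ k) powr s) \<le> ennreal (2 powr s) * diam_powr s (U j) + ennreal (\<epsilon> * (1/2) ^ Suc j))" for j k
    have "\<exists>k. fits j k" for j
    proof (cases "U j = {}")
      case False
      obtain k where k: "diameter (U j) \<le> (1/2) ^ k"
        "((1/2) ^ k) powr s \<le> 2 powr s * (if s = 0 then 1 else diameter (U j) powr s) + \<epsilon> * (1/2) ^ Suc j"
        using dyadic_scale[of "diameter (U j)" s "\<epsilon> * (1/2) ^ Suc j"] U(2)[of j] s \<epsilon>
          diameter_ge_0[OF bounded_torus, of "U j"] by auto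
      have "ennreal (((1/2) ^ k) powr s)
          \<le> ennreal (2 powr s * (if s = 0 then 1 else diameter (U j) powr s) + \<epsilon> * (1/2) ^ Suc j)"
        using k(2) by (rule ennreal_leI)
      also have "\<dots> = ennreal (2 powr s) * diam_powr s (U j) + ennreal (\<epsilon> * (1/2) ^ Suc j)"
        using False \<epsilon> by (simp add: diam_powr_def ennreal_plus ennreal_mult)
      finally show ?thesis unfolding fits_def using k(1) by blast
    qed (simp add: fits_def)
    then have "\<forall>j. \<exists>k. fits j k" by blast
    then obtain k where k: "\<forall>j. fits j (k j)"
      by (rule choice[THEN exE])
    define I where "I j = Pair (k j) ` torus_code (k j) ` U j" for j
    have "E \<subseteq> torus.covered (\<Union>j. I j)"
    proof
      fix z assume "z \<in> E"
      then obtain j where "z \<in> U j" using U(1) by auto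
      then have "(k j, torus_code (k j) z) \<in> (\<Union>j. I j)" unfolding I_def by auto
      then show "z \<in> torus.covered (\<Union>j. I j)" unfolding torus.covered_def by auto
    qed
    then have "torus.content s E \<le> weight s (\<Union>j. I j)" by (rule torus.content_le)
    also have "\<dots> \<le> (\<Sum>j. weight s (I j))" by (rule weight_UN_le)
    also have "\<dots> \<le> (\<Sum>j. ennreal ?N * (ennreal (2 powr s) * diam_powr s (U j) + ennreal (\<epsilon> * (1/2) ^ Suc j)))"
    proof (intro suminf_le)
      fix j
      show "weight s (I j) \<le> ennreal ?N * (ennreal (2 powr s) * diam_powr s (U j) + ennreal (\<epsilon> * (1/2) ^ Suc j))"
      proof (cases "U j = {}")
        case False
        then have d: "diameter (U j) \<le> (1/2) ^ k j" and
          le: "ennreal (((1/2) ^ k j) powr s) \<le> ennreal (2 powr s) * diam_powr s (U j) + ennreal (\<epsilon> * (1/2) ^ Suc j)"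
          using k[rule_format, of j] unfolding fits_def by auto
        have "weight s (I j) = (\<Sum>q\<in>I j. scale_weight s q)"
          using card_torus_code_image(1)[OF d] by (intro weight_finite) (simp add: I_def)
        also have "\<dots> = (\<Sum>q\<in>I j. ennreal (((1/2) ^ k j) powr s))"
          by (intro sum.cong refl) (auto simp: I_def scale_weight_pair)
        also have "\<dots> = of_nat (card (torus_code (k j) ` U j)) * ennreal (((1/2) ^ k j) powr s)"
          by (simp add: I_def card_image inj_on_def)
        also have "\<dots> \<le> of_nat (card (offsets :: (int^'n) set)) *
            (ennreal (2 powr s) * diam_powr s (U j) + ennreal (\<epsilon> * (1/2) ^ Suc j))"
          using card_torus_code_image(2)[OF d] le by (intro mult_mono) auto
        finally show ?thesis by (simp add: ennreal_of_nat_eq_real_of_nat)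
      qed (simp add: I_def)
    qed auto
    also have "\<dots> = ennreal ?N * (ennreal (2 powr s) * (\<Sum>j. diam_powr s (U j)) + (\<Sum>j. ennreal (\<epsilon> * (1/2) ^ Suc j)))"
      by (simp add: suminf_add[symmetric] summableI)
    also have "(\<Sum>j. ennreal (\<epsilon> * (1/2) ^ Suc j)) = ennreal (\<epsilon> * 1)"
      using sums_mult[OF power_half_series, of \<epsilon>] \<epsilon> by (intro suminf_ennreal_eq) auto
    also have "ennreal ?N * (ennreal (2 powr s) * (\<Sum>j. diam_powr s (U j)) + ennreal (\<epsilon> * 1))
        \<le> ennreal ?N * (ennreal (2 powr s) * ennreal \<epsilon> + ennreal (\<epsilon> * 1))"
      using U(3) by (intro mult_left_mono add_right_mono) (auto intro: less_imp_le)
    also have "\<dots> = ennreal (?N * (2 powr s + 1) * \<epsilon>)"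
      using \<epsilon> by (simp add: algebra_simps ennreal_mult ennreal_plus)
    also have "\<dots> \<le> ennreal \<eta>"
    proof (rule ennreal_leI)
      have "?N * (2 powr s + 1) * \<epsilon> \<le> (?N + 1) * (2 powr s + 1) * \<epsilon>"
        using \<epsilon> by (intro mult_right_mono) auto
      also have "\<dots> = \<eta>"
        unfolding \<epsilon>_def
        by (simp only: times_divide_eq_right nonzero_mult_div_cancel_left[OF less_imp_neq[OF pos, symmetric]])
      finally show "?N * (2 powr s + 1) * \<epsilon> \<le> \<eta>" .
    qed
    finally show ?thesis by simp
  qed
  then have "torus.content s E \<le> 0" by (rule ennreal_le_epsilon)
  then show ?thesis by simp
qed

text \<open>
  Take a packing by balls of radius \<open>2^-(k+1)\<close> with the largest possible number of balls. The premeasure bounds this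
  number, and by maximality every point of \<open>C\<close> is within \<open>2^-k\<close> of a centre. So only cells
  near the centres meet \<open>C\<close>.
\<close>

lemma packing_premeasure_box_count:
  fixes C :: "'n::finite torus set"
  assumes "packing_premeasure p C < \<infinity>"
  shows "\<exists>K m. 0 \<le> m \<and> (\<forall>k\<ge>K. finite (torus_code k ` C) \<and>
    real (card (torus_code k ` C)) \<le> m * ((1/2) ^ k) powr (- p))"
proof -
  let ?N = "card (offsets :: (int^'n) set)"
  obtain \<delta> where \<delta>: "0 < \<delta>" "packing_premeasure_at p \<delta> C < \<infinity>"
    using assms unfolding packing_premeasure_def INF_less_iff by auto
  then obtain M where M: "0 \<le> M" "packing_premeasure_at p \<delta> C = ennreal M"
    by (cases "packing_premeasure_at p \<delta> C" rule: ennreal_cases) auto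
  obtain K where K: "(1/2) ^ K < \<delta>" using real_arch_pow_inv[OF \<delta>(1), of "1/2"] by auto
  have "finite (torus_code k ` C) \<and>
      real (card (torus_code k ` C)) \<le> real ?N * M * ((1/2) ^ k) powr (- p)" if k: "K \<le> k" for k
  proof -
    define r :: real where "r = (1/2) ^ Suc k"
    have r0: "0 < r" unfolding r_def by simp
    have "r \<le> (1/2) ^ K" unfolding r_def using k by (intro power_decreasing) auto
    then have r\<delta>: "r \<le> \<delta>" using K by simp
    have r2: "2 * r = (1/2) ^ k" unfolding r_def by simp
    \<comment> \<open>Sets of centres of packings by balls of radius \<open>r\<close>.\<close>
    define sep where "sep Z \<longleftrightarrow> finite Z \<and> Z \<subseteq> C \<and> pairwise (\<lambda>x y. disjnt (cball x r) (cball y r)) Z" for Z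
    have bound: "real (card Z) \<le> M * ((1/2) ^ k) powr (- p)" if Z: "sep Z" for Z
    proof -
      let ?P = "(\<lambda>x. (x, r)) ` Z"
      have "finite ?P \<and> is_packing \<delta> C ?P"
        using Z r0 r\<delta> unfolding sep_def is_packing_def by (auto simp: pairwise_def)
      then have "(\<Sum>(x, r)\<in>?P. ennreal ((2 * r) powr p)) \<le> packing_premeasure_at p \<delta> C"
        unfolding packing_premeasure_at_def by (intro SUP_upper) auto
      also have "(\<Sum>(x, r)\<in>?P. ennreal ((2 * r) powr p)) = (\<Sum>x\<in>Z. ennreal ((2 * r) powr p))"
        by (subst sum.reindex) (auto simp: inj_on_def)
      also have "\<dots> = ennreal (real (card Z) * ((1/2) ^ k) powr p)"
        by (simp add: r2 ennreal_mult ennreal_of_nat_eq_real_of_nat)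
      finally have "real (card Z) * ((1/2) ^ k) powr p \<le> M"
        using M by (simp add: ennreal_le_iff)
      then show ?thesis by (simp add: powr_minus field_simps)
    qed
    have "sep {}" unfolding sep_def by simp
    moreover have "\<forall>Z. sep Z \<longrightarrow> card Z < Suc (nat \<lceil>M * ((1/2) ^ k) powr (- p)\<rceil>)"
      using order_trans[OF bound real_nat_ceiling_ge] by (auto simp: less_Suc_eq_le)
    ultimately obtain Z where Z: "sep Z" "\<And>Z'. sep Z' \<Longrightarrow> card Z' \<le> card Z"
      using ex_has_greatest_nat[of sep "{}" card] by blast
    have "torus_code k ` C \<subseteq> (\<Union>z0\<in>Z. neighbours k (torus_code k z0))"
    proof safe
      fix z assume z: "z \<in> C"
      have "\<exists>z0\<in>Z. dist z z0 \<le> 2 * r"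
      proof (cases "z \<in> Z")
        case False
        have "\<not> sep (insert z Z)"
          using Z(2)[of "insert z Z"] Z(1) False unfolding sep_def by auto
        then obtain z0 where z0: "z0 \<in> Z" "\<not> disjnt (cball z r) (cball z0 r)"
          using Z(1) z unfolding sep_def pairwise_insert by (auto simp: disjnt_sym)
        then obtain y where "dist z y \<le> r" "dist z0 y \<le> r" by (auto simp: disjnt_def)
        then have "dist z z0 \<le> 2 * r" using dist_triangle2[of z z0 y] by linarith
        with z0 show ?thesis by blast
      qed (use r0 in \<open>auto intro!: bexI[of _ z]\<close>)
      then show "torus_code k z \<in> (\<Union>z0\<in>Z. neighbours k (torus_code k z0))"
        using torus_code_near unfolding r2 by blast
    qed
    moreover have fin: "finite (\<Union>z0\<in>Z. neighbours k (torus_code k z0))"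
      using Z(1) unfolding sep_def by (auto simp: finite_neighbours)
    ultimately have "finite (torus_code k ` C)"
      and "card (torus_code k ` C) \<le> card (\<Union>z0\<in>Z. neighbours k (torus_code k z0))"
      by (auto intro: finite_subset card_mono)
    moreover have "card (\<Union>z0\<in>Z. neighbours k (torus_code k z0)) \<le> (\<Sum>z0\<in>Z. ?N)"
      using Z(1) unfolding sep_def
      by (intro order_trans[OF card_UN_le] sum_mono card_neighbours_le) auto
    ultimately have "card (torus_code k ` C) \<le> ?N * card Z"
      by (simp add: mult.commute)
    then have "real (card (torus_code k ` C)) \<le> real (?N * card Z)"
      by (simp only: of_nat_le_iff)
    also have "\<dots> \<le> real ?N * (M * ((1/2) ^ k) powr (- p))"
      using bound[OF Z(1)] by (simp add: mult_left_mono)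
    finally show ?thesis using \<open>finite (torus_code k ` C)\<close> by (simp add: mult.assoc)
  qed
  then show ?thesis using M(1) by (intro exI[of _ K] exI[of _ "real ?N * M"]) auto
qed


section \<open>Intersections with random translates\<close>

text \<open>
  The translations that can move a point of the cell \<open>c\<close> into the cell \<open>c'\<close>. An open superset of
  the exact set of differences is used in order to have measurability.
\<close>

definition difference_region :: "nat \<Rightarrow> int^'n::finite \<Rightarrow> int^'n \<Rightarrow> 'n torus set" where
  "difference_region k c c' = (\<Union>b\<in>neighbours k (c' - c). enlarged_cell (k, b))"

lemma open_difference_region: "open (difference_region k c c')"
  unfolding difference_region_def by (intro open_UN ballI open_enlarged_cell)

lemma diff_in_difference_region:
  "z' - z \<in> difference_region k (torus_code k z) (torus_code k z')"
  unfolding difference_region_def by (rule UN_I) (rule torus_code_diff, rule mem_enlarged_cell)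

lemma emeasure_difference_region_le:
  fixes c :: "int^'n::finite"
  shows "emeasure torus_lebesgue (difference_region k c c')
    \<le> ennreal (real (card (offsets :: (int^'n) set)) ^ 3 * ((1/2) ^ k) powr real CARD('n))"
proof -
  let ?N = "card (offsets :: (int^'n) set)"
  let ?v = "real ?N ^ 2 * ((1/2) ^ k) ^ CARD('n)"
  have "emeasure torus_lebesgue (difference_region k c c')
      \<le> (\<Sum>b\<in>neighbours k (c' - c). emeasure torus_lebesgue (enlarged_cell (k, b)))"
    unfolding difference_region_def
    by (intro emeasure_subadditive_finite finite_neighbours)
      (auto intro: borel_open open_enlarged_cell)
  also have "\<dots> \<le> (\<Sum>b\<in>neighbours k (c' - c). ennreal ?v)"
    by (intro sum_mono emeasure_enlarged_cell_le)
  also have "\<dots> = of_nat (card (neighbours k (c' - c))) * ennreal ?v" by simp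
  also have "\<dots> \<le> of_nat ?N * ennreal ?v"
    by (intro mult_right_mono of_nat_mono card_neighbours_le) auto
  also have "\<dots> = ennreal (real ?N * ?v)"
    by (simp add: ennreal_mult ennreal_of_nat_eq_real_of_nat)
  also have "real ?N * ?v = real ?N ^ 3 * ((1/2) ^ k) powr real CARD('n)"
    by (simp add: power3_eq_cube power2_eq_square powr_realpow)
  finally show ?thesis .
qed

text \<open>
  Cover \<open>E\<close> by cells and the part of \<open>C\<close>
  that the translate of such a cell can meet by cells of the same level. The weight of the resulting cover of
  the intersection is a function \<open>g n\<close> of the translation. Its integral is estimated by
  counting the pairs of cells and using the measure of the difference region.
\<close>

lemma content_translate_inter_null:
  fixes E C :: "'n::finite torus set"
  assumes E: "torus.content s E = 0" and s: "0 \<le> s"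
    and C: "packing_premeasure p C < \<infinity>"
    and t: "s + p - real CARD('n) \<le> t"
  shows "AE a in torus_lebesgue. torus.content t ((\<lambda>z. z + a) ` E \<inter> C) = 0"
proof -
  let ?N = "real (card (offsets :: (int^'n) set))"
  obtain K m where m: "0 \<le> m" and fin: "\<And>k. K \<le> k \<Longrightarrow> finite (torus_code k ` C)"
    and card: "\<And>k. K \<le> k \<Longrightarrow> real (card (torus_code k ` C)) \<le> m * ((1/2) ^ k) powr (- p)"
    using packing_premeasure_box_count[OF C] by auto
  obtain e :: "nat \<Rightarrow> nat \<times> (int^'n)" where e: "bij e" using ex_enumeration by blast
  have "\<exists>I. E \<subseteq> torus.covered I \<and> weight s I < ennreal ((1/2) ^ n) \<and> (\<forall>q\<in>I. K \<le> fst q)" for n :: nat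
  proof -
    \<comment> \<open>The second bound excludes cells of level up to \<open>K\<close>, where the box counts of \<open>C\<close> are not controlled.\<close>
    have "torus.content s E < ennreal (min ((1/2) ^ n) (((1/2) ^ K) powr s))"
      unfolding E by simp
    then obtain I where I: "E \<subseteq> torus.covered I"
      "weight s I < ennreal (min ((1/2) ^ n) (((1/2) ^ K) powr s))"
      by (rule torus.content_less_cover)
    have "weight s I < ennreal ((1/2) ^ n)" "weight s I < ennreal (((1/2) ^ K) powr s)"
      by (rule order.strict_trans2[OF I(2)], rule ennreal_leI, simp)+
    then show ?thesis
      using I(1) weight_less_deep[of s I K] s
      by (intro exI[of _ I]) (fastforce intro: less_imp_le)
  qed
  then obtain I where I: "\<And>n. E \<subseteq> torus.covered (I n)"
    "\<And>n. weight s (I n) < ennreal ((1/2) ^ n)" "\<And>n q. q \<in> I n \<Longrightarrow> K \<le> fst q"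
    by metis
  define D where "D q c' = difference_region (fst q) (snd q) c'" for q :: "nat \<times> (int^'n)" and c'
  have D_borel: "D q c' \<in> sets borel" for q c'
    unfolding D_def by (rule borel_open[OF open_difference_region])
  define g where "g n a = (\<Sum>i. indicator (I n) (e i) *
      (\<Sum>c'\<in>torus_code (fst (e i)) ` C. scale_weight t (e i) * indicator (D (e i) c') a))" for n a
  have g_meas: "g n \<in> borel_measurable torus_lebesgue" for n
    unfolding g_def using D_borel by measurable
  have g_le: "(\<integral>\<^sup>+a. g n a \<partial>torus_lebesgue) \<le> ennreal (m * ?N ^ 3) * ennreal ((1/2) ^ n)" for n
  proof -
    have "(\<integral>\<^sup>+a. g n a \<partial>torus_lebesgue) = (\<Sum>i. indicator (I n) (e i) *
        (\<Sum>c'\<in>torus_code (fst (e i)) ` C. scale_weight t (e i) * emeasure torus_lebesgue (D (e i) c')))"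
      unfolding g_def using D_borel
      by (subst nn_integral_suminf)
        (auto intro!: suminf_cong simp: nn_integral_cmult nn_integral_sum)
    also have "\<dots> \<le> (\<Sum>i. ennreal (m * ?N ^ 3) * (scale_weight s (e i) * indicator (I n) (e i)))"
    proof (intro suminf_le)
      fix i
      show "indicator (I n) (e i) * (\<Sum>c'\<in>torus_code (fst (e i)) ` C.
          scale_weight t (e i) * emeasure torus_lebesgue (D (e i) c'))
        \<le> ennreal (m * ?N ^ 3) * (scale_weight s (e i) * indicator (I n) (e i))"
      proof (cases "e i \<in> I n")
        case True
        define k where "k = fst (e i)"
        define h :: real where "h = (1/2) ^ k"
        have h: "0 < h" "h \<le> 1" unfolding h_def by (auto simp: power_le_one)
        have k: "K \<le> k" unfolding k_def using I(3) True by blast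
        have "(\<Sum>c'\<in>torus_code k ` C. scale_weight t (e i) * emeasure torus_lebesgue (D (e i) c'))
            \<le> (\<Sum>c'\<in>torus_code k ` C. ennreal (h powr t) * ennreal (?N ^ 3 * h powr real CARD('n)))"
          unfolding scale_weight_def D_def k_def[symmetric] h_def
          by (intro sum_mono mult_left_mono emeasure_difference_region_le) auto
        also have "\<dots> = ennreal (real (card (torus_code k ` C)) * (h powr t * (?N ^ 3 * h powr real CARD('n))))"
          by (simp add: ennreal_mult ennreal_of_nat_eq_real_of_nat)
        also have "\<dots> \<le> ennreal (m * ?N ^ 3 * h powr s)"
        proof (rule ennreal_leI)
          have "real (card (torus_code k ` C)) * (h powr t * (?N ^ 3 * h powr real CARD('n)))
              \<le> (m * h powr (- p)) * (h powr t * (?N ^ 3 * h powr real CARD('n)))"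
            using card[OF k] unfolding h_def by (intro mult_right_mono) auto
          also have "\<dots> = m * ?N ^ 3 * h powr (t + real CARD('n) - p)"
            using h by (simp add: powr_add powr_diff powr_minus field_simps)
          also have "\<dots> \<le> m * ?N ^ 3 * h powr s"
            using t h m by (intro mult_left_mono powr_mono') auto
          finally show "real (card (torus_code k ` C)) * (h powr t * (?N ^ 3 * h powr real CARD('n)))
              \<le> m * ?N ^ 3 * h powr s" .
        qed
        also have "\<dots> = ennreal (m * ?N ^ 3) * scale_weight s (e i)"
          using m by (simp add: scale_weight_def h_def k_def ennreal_mult)
        finally show ?thesis using True by (simp add: k_def)
      qed simp
    qed auto
    also have "\<dots> = ennreal (m * ?N ^ 3) * weight s (I n)"
      unfolding weight_enumerated[OF e] by simp
    also have "\<dots> \<le> ennreal (m * ?N ^ 3) * ennreal ((1/2) ^ n)"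
      using I(2) by (intro mult_left_mono) (auto intro: less_imp_le)
    finally show ?thesis .
  qed
  have cover: "torus.content t ((\<lambda>z. z + a) ` E \<inter> C) \<le> g n a" for n a
  proof -
    \<comment> \<open>The cells that meet \<open>C\<close> and that the translate of the cell \<open>e i\<close> may reach.\<close>
    define J where "J i = (if e i \<in> I n
      then Pair (fst (e i)) ` {c' \<in> torus_code (fst (e i)) ` C. a \<in> D (e i) c'} else {})" for i
    have "(\<lambda>z. z + a) ` E \<inter> C \<subseteq> torus.covered (\<Union>i. J i)"
    proof
      fix z' assume "z' \<in> (\<lambda>z. z + a) ` E \<inter> C"
      then obtain z where z: "z \<in> E" "z' = z + a" "z' \<in> C" by blast
      obtain k where k: "(k, torus_code k z) \<in> I n"
        using I(1)[of n] z(1) unfolding torus.covered_def by auto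
      obtain i where i: "e i = (k, torus_code k z)" using e by (metis bij_pointE)
      have "a = z' - z" using z(2) by simp
      then have "a \<in> D (e i) (torus_code k z')"
        unfolding D_def i using diff_in_difference_region by auto
      then have "(k, torus_code k z') \<in> J i" using z(3) i k unfolding J_def by auto
      then show "z' \<in> torus.covered (\<Union>i. J i)" unfolding torus.covered_def by auto
    qed
    then have "torus.content t ((\<lambda>z. z + a) ` E \<inter> C) \<le> weight t (\<Union>i. J i)"
      by (rule torus.content_le)
    also have "\<dots> \<le> (\<Sum>i. weight t (J i))" by (rule weight_UN_le)
    also have "\<dots> \<le> g n a"
      unfolding g_def
    proof (intro suminf_le)
      fix i
      show "weight t (J i) \<le> indicator (I n) (e i) *
          (\<Sum>c'\<in>torus_code (fst (e i)) ` C. scale_weight t (e i) * indicator (D (e i) c') a)"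
      proof (cases "e i \<in> I n")
        case True
        let ?T = "torus_code (fst (e i)) ` C"
        have T: "finite ?T" using fin I(3) True by blast
        have "weight t (J i) = (\<Sum>q\<in>J i. scale_weight t q)"
          using T True by (intro weight_finite) (simp add: J_def)
        also have "\<dots> = (\<Sum>c'\<in>{c' \<in> ?T. a \<in> D (e i) c'}. scale_weight t (fst (e i), c'))"
          using True unfolding J_def by (simp add: sum.reindex inj_on_def)
        also have "\<dots> = (\<Sum>c'\<in>?T. if a \<in> D (e i) c' then scale_weight t (fst (e i), c') else 0)"
          by (rule sum.inter_filter[OF T])
        also have "\<dots> = (\<Sum>c'\<in>?T. scale_weight t (e i) * indicator (D (e i) c') a)"
          by (intro sum.cong refl) (auto simp: scale_weight_def)
        finally show ?thesis using True by simp
      qed (simp add: J_def)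
    qed auto
    finally show ?thesis .
  qed
  define f where "f a = (INF n. g n a)" for a
  have f_meas: "f \<in> borel_measurable torus_lebesgue" unfolding f_def using g_meas by measurable
  have "(\<integral>\<^sup>+a. f a \<partial>torus_lebesgue) \<le> ennreal (m * ?N ^ 3 * (1/2) ^ n)" for n
  proof -
    have "(\<integral>\<^sup>+a. f a \<partial>torus_lebesgue) \<le> (\<integral>\<^sup>+a. g n a \<partial>torus_lebesgue)"
      unfolding f_def by (intro nn_integral_mono INF_lower) simp
    also have "\<dots> \<le> ennreal (m * ?N ^ 3) * ennreal ((1/2) ^ n)" by (rule g_le)
    also have "\<dots> = ennreal (m * ?N ^ 3 * (1/2) ^ n)" using m by (simp add: ennreal_mult)
    finally show ?thesis .
  qed
  moreover have "(\<lambda>n. ennreal (m * ?N ^ 3 * (1/2) ^ n)) \<longlonglongrightarrow> ennreal (m * ?N ^ 3 * 0)"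
    by (intro tendsto_ennrealI tendsto_mult tendsto_const LIMSEQ_realpow_zero) auto
  ultimately have "(\<integral>\<^sup>+a. f a \<partial>torus_lebesgue) \<le> ennreal (m * ?N ^ 3 * 0)"
    by (intro LIMSEQ_le_const) auto
  then have "AE a in torus_lebesgue. f a = 0"
    using nn_integral_0_iff_AE[OF f_meas] by simp
  then show ?thesis
  proof eventually_elim
    case (elim a)
    have "torus.content t ((\<lambda>z. z + a) ` E \<inter> C) \<le> f a"
      unfolding f_def by (intro INF_greatest cover)
    with elim show ?case by simp
  qed
qed

text \<open>
  A set of packing measure zero is a countable union of pieces of finite packing premeasure.
\<close>

lemma AE_translate_inter_content_null:
  fixes E F :: "'n::finite torus set"
  assumes E: "hausdorff_measure s E = 0" "0 \<le> s" and F: "packing_measure p F = 0"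
    and t: "s + p - real CARD('n) \<le> t"
  shows "AE a in torus_lebesgue. torus.content t ((\<lambda>z. z + a) ` E \<inter> F) = 0"
proof -
  have "packing_measure p F < 1" using F by simp
  then obtain C :: "nat \<Rightarrow> 'n torus set" where C: "F \<subseteq> (\<Union>i. C i)"
    "(\<Sum>i. packing_premeasure p (C i)) < 1"
    unfolding packing_measure_def INF_less_iff by auto
  have "packing_premeasure p (C i) < \<infinity>" for i
    using ennreal_suminf_lessD[OF C(2), of i] by (rule less_trans) simp
  then have "AE a in torus_lebesgue. \<forall>i. torus.content t ((\<lambda>z. z + a) ` E \<inter> C i) = 0"
    unfolding AE_all_countable
    using content_translate_inter_null[OF content_eq_0_if_hausdorff_measure_eq_0[OF E] E(2) _ t] by blast
  then show ?thesis
  proof eventually_elim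
    case (elim a)
    have "torus.content t (\<Union>i. (\<lambda>z. z + a) ` E \<inter> C i) = 0"
      using elim by (intro torus.content_UN_null) auto
    moreover have "(\<lambda>z. z + a) ` E \<inter> F \<subseteq> (\<Union>i. (\<lambda>z. z + a) ` E \<inter> C i)"
      using C(1) by blast
    ultimately show ?case using torus.content_mono by (metis le_zero_eq)
  qed
qed

text \<open>
  An open-cover version of the statement that \<open>S\<close> has content at least \<open>c\<close>, equivalent to
  it up to a constant for compact sets. Because the enlarged cells are open and only finite
  families occur, it behaves well under decreasing intersections and defines a closed condition
  on the sections of a closed set.
\<close>

definition large_section :: "real \<Rightarrow> ennreal \<Rightarrow> 'n::finite torus set \<Rightarrow> bool" where
  "large_section t c S \<longleftrightarrow>
     (\<forall>I. finite I \<longrightarrow> S \<subseteq> (\<Union>q\<in>I. enlarged_cell q) \<longrightarrow> c \<le> weight t I)"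

lemma large_section_mono: "large_section t c S \<Longrightarrow> S \<subseteq> S' \<Longrightarrow> large_section t c S'"
  unfolding large_section_def by blast

lemma large_section_if_content:
  fixes S :: "'n::finite torus set"
  assumes "of_nat (card (offsets :: (int^'n) set)) * c < torus.content t S"
  shows "large_section t c S"
  unfolding large_section_def
proof (intro allI impI, rule ccontr)
  let ?N = "card (offsets :: (int^'n) set)"
  fix I :: "(nat \<times> (int^'n)) set"
  assume I: "finite I" "S \<subseteq> (\<Union>q\<in>I. enlarged_cell q)" "\<not> c \<le> weight t I"
  define J where "J = (\<Union>q\<in>I. Pair (fst q) ` neighbours (fst q) (snd q))"
  have "S \<subseteq> torus.covered J"
  proof
    fix z assume "z \<in> S"
    then obtain q where q: "q \<in> I" "z \<in> enlarged_cell q" using I(2) by blast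
    then have "torus_code (fst q) z \<in> neighbours (fst q) (snd q)"
      using enlarged_cell_subset[of z "fst q" "snd q"] by simp
    then have "(fst q, torus_code (fst q) z) \<in> J" using q(1) unfolding J_def by blast
    then show "z \<in> torus.covered J" unfolding torus.covered_def by auto
  qed
  then have "torus.content t S \<le> weight t J" by (rule torus.content_le)
  also have "\<dots> \<le> (\<Sum>q\<in>I. weight t (Pair (fst q) ` neighbours (fst q) (snd q)))"
    unfolding J_def weight_def using I(1) by (intro emeasure_subadditive_finite) auto
  also have "\<dots> \<le> (\<Sum>q\<in>I. of_nat ?N * scale_weight t q)"
  proof (intro sum_mono)
    fix q :: "nat \<times> (int^'n)"
    have "weight t (Pair (fst q) ` neighbours (fst q) (snd q))
        = (\<Sum>c\<in>neighbours (fst q) (snd q). scale_weight t (fst q, c))"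
      by (subst weight_finite) (auto simp: finite_neighbours sum.reindex inj_on_def)
    also have "\<dots> = of_nat (card (neighbours (fst q) (snd q))) * scale_weight t q"
      by (simp add: scale_weight_def)
    also have "\<dots> \<le> of_nat ?N * scale_weight t q"
      by (intro mult_right_mono of_nat_mono card_neighbours_le) auto
    finally show "weight t (Pair (fst q) ` neighbours (fst q) (snd q)) \<le> of_nat ?N * scale_weight t q" .
  qed
  also have "\<dots> = of_nat ?N * weight t I"
    using I(1) by (simp add: weight_finite sum_distrib_left)
  also have "\<dots> \<le> of_nat ?N * c" using I(3) by (intro mult_left_mono) auto
  finally show False using assms by simp
qed

lemma content_if_large_section:
  fixes K :: "'n::finite torus set"
  assumes "compact K" "large_section t c K"
  shows "c \<le> torus.content t K"
  unfolding torus.content_def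
proof (rule INF_greatest)
  fix I assume "I \<in> {I. K \<subseteq> torus.covered I}"
  then have I: "K \<subseteq> torus.covered I" by simp
  have "K \<subseteq> (\<Union>q\<in>I. enlarged_cell q)"
  proof
    fix z assume "z \<in> K"
    then obtain k where "(k, torus_code k z) \<in> I" using I unfolding torus.covered_def by auto
    then show "z \<in> (\<Union>q\<in>I. enlarged_cell q)" using mem_enlarged_cell by blast
  qed
  then obtain I' where I': "I' \<subseteq> I" "finite I'" "K \<subseteq> (\<Union>q\<in>I'. enlarged_cell q)"
    using compactE_image[OF assms(1), of I enlarged_cell] open_enlarged_cell by metis
  have "c \<le> weight t I'" using assms(2) I' unfolding large_section_def by blast
  also have "\<dots> \<le> weight t I" using I'(1) by (rule weight_mono)
  finally show "c \<le> weight t I" .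
qed

lemma large_section_INT:
  fixes K :: "nat \<Rightarrow> 'n::finite torus set"
  assumes K: "decseq K" "\<And>j. closed (K j)" and large: "\<And>j. large_section t c (K j)"
  shows "large_section t c (\<Inter>j. K j)"
  unfolding large_section_def
proof (intro allI impI)
  fix I :: "(nat \<times> (int^'n)) set"
  assume I: "finite I" "(\<Inter>j. K j) \<subseteq> (\<Union>q\<in>I. enlarged_cell q)"
  let ?U = "\<Union>q\<in>I. enlarged_cell q"
  have U: "open ?U" by (intro open_UN ballI open_enlarged_cell)
  have op: "open (- (K j) \<union> ?U)" for j
    using K(2) U by (intro open_Un open_Compl)
  have cov: "UNIV \<subseteq> (\<Union>j\<in>UNIV. - (K j) \<union> ?U)" using I(2) by auto
  obtain J where J: "J \<subseteq> UNIV" "finite J" "UNIV \<subseteq> (\<Union>j\<in>J. - (K j) \<union> ?U)"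
    by (rule compactE_image[where f = "\<lambda>j. - (K j) \<union> ?U", OF compact_UNIV_torus op cov])
  have "K (Max J) \<subseteq> ?U"
  proof
    fix z assume z: "z \<in> K (Max J)"
    have "z \<in> (\<Union>j\<in>J. - (K j) \<union> ?U)" by (rule subsetD[OF J(3) UNIV_I])
    then obtain j where j: "j \<in> J" "z \<in> - (K j) \<union> ?U" by (rule UN_E)
    have "z \<in> K j" using decseqD[OF K(1) Max_ge[OF J(2) j(1)]] z by blast
    then show "z \<in> ?U" using j(2) by blast
  qed
  then show "c \<le> weight t I" using large[of "Max J"] I(1) unfolding large_section_def by blast
qed

text \<open>
  By the tube lemma, if an open set contains the section at \<open>x\<close>, then it contains all sections at nearby
  points.
\<close>

lemma closed_large_sections:
  fixes K :: "('a::topological_space \<times> 'n::finite torus) set"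
  assumes "closed K"
  shows "closed {x. large_section t c {z. (x, z) \<in> K}}"
proof -
  have op: "open {x. {z. (x, z) \<in> K} \<subseteq> U}" if U: "open U" for U
  proof (subst open_subopen, intro ballI)
    fix x assume x: "x \<in> {x. {z. (x, z) \<in> K} \<subseteq> U}"
    let ?W = "- K \<union> UNIV \<times> U"
    have W: "open ?W" using assms U by (intro open_Un open_Compl open_Times) auto
    have sub: "{x} \<times> UNIV \<subseteq> ?W" using x by auto
    obtain X where X: "x \<in> X" "open X" "X \<times> UNIV \<subseteq> ?W"
      using Elementary_Topology.tube_lemma[OF compact_UNIV_torus W sub] by auto
    have "X \<subseteq> {x. {z. (x, z) \<in> K} \<subseteq> U}" using X(3) by auto
    with X show "\<exists>T. open T \<and> x \<in> T \<and> T \<subseteq> {x. {z. (x, z) \<in> K} \<subseteq> U}"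
      by (intro exI[of _ X] conjI)
  qed
  have "- {x. large_section t c {z. (x, z) \<in> K}}
      = (\<Union>I\<in>{I. finite I \<and> \<not> c \<le> weight t I}. {x. {z. (x, z) \<in> K} \<subseteq> (\<Union>q\<in>I. enlarged_cell q)})"
    unfolding large_section_def by auto
  also have "open \<dots>" by (intro open_UN ballI op open_enlarged_cell)
  finally show ?thesis by (simp add: closed_def)
qed


section \<open>Projections of closed sets and Choquet capacitability\<close>

text \<open>
  In a metric space every analytic set has this form
  (\<open>closed_projection_analytic\<close>). The witnesses are real sequences, a space homeomorphic to all its
  countable powers; this makes the closure properties easy.
\<close>

definition closed_projection :: "'a::topological_space set \<Rightarrow> bool" where
  "closed_projection S \<longleftrightarrow>
     (\<exists>C :: ('a \<times> (nat \<Rightarrow> real)) set. closed C \<and> S = {a. \<exists>w. (a, w) \<in> C})"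

lemma closed_projectionI:
  fixes C :: "('a::topological_space \<times> (nat \<Rightarrow> real)) set"
  assumes "closed C" "\<And>a. a \<in> S \<longleftrightarrow> (\<exists>w. (a, w) \<in> C)"
  shows "closed_projection S"
  unfolding closed_projection_def using assms by (intro exI[of _ C]) auto

lemma closed_projectionD:
  fixes S :: "'a::topological_space set"
  assumes "closed_projection S"
  shows "\<exists>C :: ('a \<times> (nat \<Rightarrow> real)) set. closed C \<and> (\<forall>a. a \<in> S \<longleftrightarrow> (\<exists>w. (a, w) \<in> C))"
  using assms unfolding closed_projection_def by auto

lemma continuous_on_reindexed_snd:
  "continuous_on UNIV (\<lambda>p :: 'a::topological_space \<times> (nat \<Rightarrow> real). (fst p, \<lambda>i::nat. snd p (h i)))"
proof -
  have "continuous_on UNIV (\<lambda>p :: 'a \<times> (nat \<Rightarrow> real). snd p (h i))" for i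
    by (rule continuous_on_product_then_coordinatewise[OF continuous_on_snd[OF continuous_on_id]])
  then show ?thesis
    by (intro continuous_on_Pair continuous_on_fst continuous_on_id
        continuous_on_coordinatewise_then_product)
qed

lemma closed_reindexed:
  fixes C :: "('a::topological_space \<times> (nat \<Rightarrow> real)) set"
  assumes "closed C"
  shows "closed {p :: 'a \<times> (nat \<Rightarrow> real). (fst p, \<lambda>i. snd p (h i)) \<in> C}"
  using closed_vimage[OF assms continuous_on_reindexed_snd[of h]] by (simp add: vimage_def)

lemma closed_projection_closed: "closed S \<Longrightarrow> closed_projection S"
  by (rule closed_projectionI[of "S \<times> UNIV"]) (auto intro: closed_Times)

lemma closed_projection_vimage:
  fixes f :: "'a::topological_space \<Rightarrow> 'b::topological_space"
  assumes f: "continuous_on UNIV f" and S: "closed_projection S"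
  shows "closed_projection (f -` S)"
proof -
  obtain C :: "('b \<times> (nat \<Rightarrow> real)) set" where C: "closed C" "\<forall>a. a \<in> S \<longleftrightarrow> (\<exists>w. (a, w) \<in> C)"
    using closed_projectionD[OF S] by blast
  have "continuous_on UNIV (\<lambda>p :: 'a \<times> (nat \<Rightarrow> real). (f (fst p), snd p))"
    by (intro continuous_on_Pair continuous_on_snd continuous_on_id
        continuous_on_compose2[OF f continuous_on_fst[OF continuous_on_id]]) auto
  then have "closed ((\<lambda>p. (f (fst p), snd p)) -` C)"
    by (rule closed_vimage[OF C(1)])
  then show ?thesis by (rule closed_projectionI) (simp add: C(2))
qed

text \<open>
  The countably many witnesses are interleaved to a single one.
\<close>

lemma closed_projection_INT:
  fixes S :: "nat \<Rightarrow> 'a::topological_space set"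
  assumes "\<And>n. closed_projection (S n)"
  shows "closed_projection (\<Inter>n. S n)"
proof -
  have "\<exists>C :: ('a \<times> (nat \<Rightarrow> real)) set. closed C \<and> (\<forall>a. a \<in> S n \<longleftrightarrow> (\<exists>w. (a, w) \<in> C))" for n
    by (rule closed_projectionD[OF assms])
  then obtain C :: "nat \<Rightarrow> ('a \<times> (nat \<Rightarrow> real)) set" where C: "\<And>n. closed (C n)"
    "\<And>n a. a \<in> S n \<longleftrightarrow> (\<exists>w. (a, w) \<in> C n)" by metis
  define D where "D = (\<Inter>n. {p. (fst p, \<lambda>i. snd p (prod_encode (n, i))) \<in> C n})"
  have "closed D" unfolding D_def by (intro closed_INT ballI closed_reindexed C(1))
  then show ?thesis
  proof (rule closed_projectionI)
    fix a
    show "a \<in> (\<Inter>n. S n) \<longleftrightarrow> (\<exists>w. (a, w) \<in> D)"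
    proof
      assume "a \<in> (\<Inter>n. S n)"
      then have "\<forall>n. \<exists>w. (a, w) \<in> C n" using C(2) by auto
      then obtain w where w: "\<And>n. (a, w n) \<in> C n" by metis
      have "(a, \<lambda>j. w (fst (prod_decode j)) (snd (prod_decode j))) \<in> D"
        unfolding D_def using w by simp
      then show "\<exists>w. (a, w) \<in> D" by blast
    next
      assume "\<exists>w. (a, w) \<in> D"
      then show "a \<in> (\<Inter>n. S n)" unfolding D_def using C(2) by auto
    qed
  qed
qed

lemma closed_projection_Int:
  assumes "closed_projection S" "closed_projection T"
  shows "closed_projection (S \<inter> T)"
proof -
  have "S \<inter> T = (\<Inter>n::nat. if n = 0 then S else T)" by auto
  then show ?thesis using closed_projection_INT[of "\<lambda>n. if n = 0 then S else T"] assms by simp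
qed

text \<open>
  The first entry of the witness names a set of the union. The condition is closed, and it forces the remaining
  entries to be a witness for every index at distance less than \<open>1\<close> from the first entry. There is at
  least one such index.
\<close>

lemma closed_projection_UN:
  fixes S :: "nat \<Rightarrow> 'a::topological_space set"
  assumes "\<And>n. closed_projection (S n)"
  shows "closed_projection (\<Union>n. S n)"
proof -
  have "\<exists>C :: ('a \<times> (nat \<Rightarrow> real)) set. closed C \<and> (\<forall>a. a \<in> S n \<longleftrightarrow> (\<exists>w. (a, w) \<in> C))" for n
    by (rule closed_projectionD[OF assms])
  then obtain C :: "nat \<Rightarrow> ('a \<times> (nat \<Rightarrow> real)) set" where C: "\<And>n. closed (C n)"
    "\<And>n a. a \<in> S n \<longleftrightarrow> (\<exists>w. (a, w) \<in> C n)" by metis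
  define D where "D = {p. 0 \<le> snd p 0} \<inter>
    (\<Inter>n. {p. 1 \<le> \<bar>snd p 0 - real n\<bar>} \<union> {p. (fst p, \<lambda>i. snd p (Suc i)) \<in> C n})"
  have c0: "continuous_on UNIV (\<lambda>p :: 'a \<times> (nat \<Rightarrow> real). snd p 0)"
    by (rule continuous_on_product_then_coordinatewise[OF continuous_on_snd[OF continuous_on_id]])
  have "closed D" unfolding D_def
    by (intro closed_Int closed_INT ballI closed_Un closed_reindexed C(1) closed_Collect_le
        continuous_intros c0)
  then show ?thesis
  proof (rule closed_projectionI)
    fix a
    show "a \<in> (\<Union>n. S n) \<longleftrightarrow> (\<exists>w. (a, w) \<in> D)"
    proof
      assume "a \<in> (\<Union>n. S n)"
      then obtain n w where w: "(a, w) \<in> C n" using C(2) by auto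
      have "1 \<le> \<bar>real n - real m\<bar> \<or> (a, w) \<in> C m" for m
        using w by (cases "m = n") auto
      then have "(a, case_nat (real n) w) \<in> D"
        unfolding D_def by auto
      then show "\<exists>w. (a, w) \<in> D" by blast
    next
      assume "\<exists>w. (a, w) \<in> D"
      then obtain w where w: "(a, w) \<in> D" by blast
      define n where "n = nat \<lfloor>w 0\<rfloor>"
      have "0 \<le> w 0" using w unfolding D_def by auto
      then have "\<bar>w 0 - real n\<bar> < 1" unfolding n_def by simp linarith
      moreover have "1 \<le> \<bar>w 0 - real n\<bar> \<or> (a, \<lambda>i. w (Suc i)) \<in> C n"
        using w unfolding D_def by auto
      ultimately have "(a, \<lambda>i. w (Suc i)) \<in> C n" by linarith
      then show "a \<in> (\<Union>n. S n)" using C(2) by auto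
    qed
  qed
qed

lemma closed_projection_open:
  fixes S :: "'a::metric_space set"
  assumes "open S"
  shows "closed_projection S"
proof (cases "S = UNIV")
  case False
  have "S = (\<Union>n. {x. 1 / real (Suc n) \<le> infdist x (- S)})"
  proof (intro set_eqI iffI)
    fix x assume "x \<in> S"
    then have "infdist x (- S) \<noteq> 0"
      using in_closed_iff_infdist_zero[of "- S" x] assms False by auto
    then have "0 < infdist x (- S)" using infdist_nonneg[of x "- S"] by linarith
    then obtain n where "1 / real (Suc n) < infdist x (- S)"
      using nat_approx_posE by blast
    then show "x \<in> (\<Union>n. {x. 1 / real (Suc n) \<le> infdist x (- S)})" by (auto intro: less_imp_le)
  next
    fix x assume "x \<in> (\<Union>n. {x. 1 / real (Suc n) \<le> infdist x (- S)})"
    then obtain n where n: "1 / real (Suc n) \<le> infdist x (- S)" by auto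
    have "0 < 1 / real (Suc n)" by simp
    with n have "infdist x (- S) \<noteq> 0" by linarith
    then show "x \<in> S" by (metis ComplI infdist_zero)
  qed
  moreover have "closed_projection (\<Union>n. {x. 1 / real (Suc n) \<le> infdist x (- S)})"
    by (intro closed_projection_UN closed_projection_closed closed_Collect_le continuous_intros)
  ultimately show ?thesis by simp
qed (simp add: closed_projection_closed)

lemma closed_projection_borel:
  fixes B :: "'a::metric_space set"
  assumes "B \<in> sets borel"
  shows "closed_projection B"
proof -
  have "B \<in> sigma_sets UNIV {S. open S}" using assms by (simp add: sets_borel)
  then have "closed_projection B \<and> closed_projection (- B)"
  proof induction
    case (Basic S)
    then show ?case by (auto intro: closed_projection_open closed_projection_closed)
  next
    case Empty
    then show ?case by (auto intro: closed_projection_closed)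
  next
    case (Compl S)
    then show ?case by (simp add: Compl_eq_Diff_UNIV[symmetric])
  next
    case (Union S)
    have "- (\<Union>n. S n) = (\<Inter>n. - S n)" by auto
    then show ?case using Union.IH closed_projection_UN[of S] closed_projection_INT[of "\<lambda>n. - S n"]
      by auto
  qed
  then show ?thesis by simp
qed

lemma closure_graph_imp_graph:
  fixes f :: "'a::metric_space \<Rightarrow> 'b::metric_space"
  assumes f: "continuous_on B f" and b: "b \<in> B" and cl: "(b, z) \<in> closure ((\<lambda>b. (b, f b)) ` B)"
  shows "z = f b"
proof -
  obtain p where p: "\<And>n. p n \<in> (\<lambda>b. (b, f b)) ` B" "p \<longlonglongrightarrow> (b, z)"
    using cl unfolding closure_sequential by blast
  have in_B: "fst (p n) \<in> B" and snd_p: "snd (p n) = f (fst (p n))" for n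
    using p(1)[of n] by auto
  have "(\<lambda>n. fst (p n)) \<longlonglongrightarrow> b" "(\<lambda>n. snd (p n)) \<longlonglongrightarrow> z"
    using tendsto_fst[OF p(2)] tendsto_snd[OF p(2)] by auto
  moreover from this(1) have "(\<lambda>n. f (fst (p n))) \<longlonglongrightarrow> f b"
    using f b in_B unfolding continuous_on_sequentially by (auto simp: o_def)
  ultimately show ?thesis unfolding snd_p by (metis LIMSEQ_unique)
qed

text \<open>
  The point \<open>z\<close> is in \<open>f ` B\<close> iff some \<open>b \<in> B\<close> has \<open>(b, z)\<close> in the closure of the graph of \<open>f\<close>. The
  even entries of the witness are \<open>b\<close>, the odd ones show that \<open>b \<in> B\<close>.
\<close>

lemma closed_projection_analytic:
  fixes S :: "'a::metric_space set"
  assumes "analytic_set S"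
  shows "closed_projection S"
proof -
  obtain B :: "(nat \<Rightarrow> real) set" and f where B: "B \<in> sets borel" and f: "continuous_on B f"
    and S: "f ` B = S" using assms unfolding analytic_set_def by blast
  obtain C :: "((nat \<Rightarrow> real) \<times> (nat \<Rightarrow> real)) set"
    where C: "closed C" "\<forall>b. b \<in> B \<longleftrightarrow> (\<exists>w. (b, w) \<in> C)"
    using closed_projectionD[OF closed_projection_borel[OF B]] by blast
  let ?G = "closure ((\<lambda>b. (b, f b)) ` B)"
  define ev :: "(nat \<Rightarrow> real) \<Rightarrow> nat \<Rightarrow> real" where "ev w i = w (2 * i)" for w i
  define od :: "(nat \<Rightarrow> real) \<Rightarrow> nat \<Rightarrow> real" where "od w i = w (2 * i + 1)" for w i
  have cont_w: "continuous_on UNIV (\<lambda>p :: 'a \<times> (nat \<Rightarrow> real). snd p i)" for i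
    by (rule continuous_on_product_then_coordinatewise[OF continuous_on_snd[OF continuous_on_id]])
  have cont_ev: "continuous_on UNIV (\<lambda>p :: 'a \<times> (nat \<Rightarrow> real). ev (snd p))"
    and cont_od: "continuous_on UNIV (\<lambda>p :: 'a \<times> (nat \<Rightarrow> real). od (snd p))"
    unfolding ev_def od_def by (intro continuous_on_coordinatewise_then_product cont_w)+
  define D where "D = (\<lambda>p :: 'a \<times> (nat \<Rightarrow> real). (ev (snd p), od (snd p))) -` C
      \<inter> (\<lambda>p. (ev (snd p), fst p)) -` ?G"
  have "closed D"
    unfolding D_def
    by (intro closed_Int closed_vimage C(1) closed_closure continuous_on_Pair cont_ev cont_od
        continuous_on_fst continuous_on_id)
  then show ?thesis
  proof (rule closed_projectionI)
    fix z
    show "z \<in> S \<longleftrightarrow> (\<exists>w. (z, w) \<in> D)"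
    proof
      assume "z \<in> S"
      then obtain b w where b: "b \<in> B" "z = f b" "(b, w) \<in> C" using S C(2) by blast
      define v where "v n = (if even n then b (n div 2) else w (n div 2))" for n
      have "ev v = b" "od v = w" unfolding ev_def od_def v_def by auto
      moreover have "(b, z) \<in> ?G" using b by (intro subsetD[OF closure_subset]) auto
      ultimately have "(z, v) \<in> D" unfolding D_def using b(3) by simp
      then show "\<exists>w. (z, w) \<in> D" by blast
    next
      assume "\<exists>w. (z, w) \<in> D"
      then obtain w where w: "(ev w, od w) \<in> C" "(ev w, z) \<in> ?G" unfolding D_def by auto
      then have "ev w \<in> B" using C(2) by blast
      moreover from this have "z = f (ev w)" using closure_graph_imp_graph[OF f _ w(2)] by simp
      ultimately show "z \<in> S" using S by blast
    qed
  qed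
qed

definition bounded_witness :: "('a \<times> (nat \<Rightarrow> real)) set \<Rightarrow> (nat \<Rightarrow> real) \<Rightarrow> nat \<Rightarrow> 'a set" where
  "bounded_witness C m k = {a. \<exists>w. (a, w) \<in> C \<and> (\<forall>i<k. \<bar>w i\<bar> \<le> m i)}"

lemma bounded_witness_antimono: "k \<le> l \<Longrightarrow> bounded_witness C m l \<subseteq> bounded_witness C m k"
  unfolding bounded_witness_def by (blast intro: less_le_trans)

lemma compact_coordinate_box:
  fixes m :: "nat \<Rightarrow> real"
  shows "compact {w. \<forall>i. \<bar>w i\<bar> \<le> m i}"
proof -
  have "compactin (product_topology (\<lambda>_::nat. euclidean :: real topology) UNIV) (PiE UNIV (\<lambda>i. {- m i..m i}))"
    unfolding compactin_PiE by simp
  then have "compact (PiE UNIV (\<lambda>i. {- m i..m i}))"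
    by (simp add: euclidean_product_topology)
  moreover have "PiE UNIV (\<lambda>i. {- m i..m i}) = {w. \<forall>i. - m i \<le> w i \<and> w i \<le> m i}"
    by auto
  moreover have "- m i \<le> w i \<and> w i \<le> m i \<longleftrightarrow> \<bar>w i\<bar> \<le> m i" for w i by linarith
  ultimately show ?thesis by simp
qed

lemma tendsto_coordinatewiseD:
  fixes v :: "nat \<Rightarrow> nat \<Rightarrow> real"
  assumes "v \<longlonglongrightarrow> w"
  shows "(\<lambda>n. v n i) \<longlonglongrightarrow> w i"
proof -
  have "continuous_on UNIV (\<lambda>x :: nat \<Rightarrow> real. x i)"
    by (rule continuous_on_product_coordinates)
  then have "isCont (\<lambda>x :: nat \<Rightarrow> real. x i) w"
    using continuous_on_eq_continuous_at[OF open_UNIV] by blast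
  then show ?thesis using assms by (rule isCont_tendsto_compose)
qed

lemma tendsto_coordinatewiseI:
  fixes v :: "nat \<Rightarrow> nat \<Rightarrow> real"
  assumes "\<And>i. (\<lambda>n. v n i) \<longlonglongrightarrow> w i"
  shows "v \<longlonglongrightarrow> w"
  using assms limitin_componentwise[of "\<lambda>_. euclidean" UNIV v w sequentially]
  by (simp add: euclidean_product_topology)

text \<open>
  Points near \<open>a\<close> have witnesses with more and more bounded entries. These accumulate at a witness
  for \<open>a\<close> in the coordinatewise topology, since the box given by the bounds is compact.
\<close>

lemma INT_closure_bounded_witness:
  fixes C :: "('a::metric_space \<times> (nat \<Rightarrow> real)) set"
  assumes C: "closed C" and a: "\<And>k. a \<in> closure (bounded_witness C m k)"
  shows "\<exists>w. (a, w) \<in> C"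
proof -
  have "\<exists>b w. (b, w) \<in> C \<and> (\<forall>i<k. \<bar>w i\<bar> \<le> m i) \<and> dist b a < 1 / real (Suc k)" for k
  proof -
    have "\<exists>b\<in>bounded_witness C m k. dist b a < 1 / real (Suc k)"
      using a[of k] unfolding closure_approachable by auto
    then show ?thesis unfolding bounded_witness_def by auto
  qed
  then obtain b w where bw: "\<And>k. (b k, w k) \<in> C" "\<And>k i. i < k \<Longrightarrow> \<bar>w k i\<bar> \<le> m i"
    "\<And>k. dist (b k) a < 1 / real (Suc k)" by metis
  \<comment> \<open>Only the first \<open>k\<close> entries of \<open>w k\<close> are bounded. Cutting off the others moves the sequence into a
    compact box and changes every entry only finitely often.\<close>
  define v where "v k i = (if i < k then w k i else 0)" for k i
  have "v k \<in> {w. \<forall>i. \<bar>w i\<bar> \<le> \<bar>m i\<bar>}" for k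
    unfolding v_def using bw(2)[of _ k] by (auto intro: order_trans[OF _ abs_ge_self])
  then obtain u r where r: "strict_mono r" "(v \<circ> r) \<longlonglongrightarrow> u"
    using compact_coordinate_box[of "\<lambda>i. \<bar>m i\<bar>"] unfolding compact_eq_seq_compact_metric seq_compact_def
    by metis
  have "(\<lambda>n. w (r n)) \<longlonglongrightarrow> u"
  proof (rule tendsto_coordinatewiseI)
    fix i
    have "(\<lambda>n. v (r n) i) \<longlonglongrightarrow> u i" using tendsto_coordinatewiseD[OF r(2), of i] by simp
    moreover have "\<forall>\<^sub>F n in sequentially. v (r n) i = w (r n) i"
      using eventually_gt_at_top[of i]
    proof eventually_elim
      case (elim n)
      then show ?case using seq_suble[OF r(1), of n] unfolding v_def by simp
    qed
    ultimately show "(\<lambda>n. w (r n) i) \<longlonglongrightarrow> u i" by (rule Lim_transform_eventually)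
  qed
  moreover have "(\<lambda>n. b (r n)) \<longlonglongrightarrow> a"
  proof -
    have "(\<lambda>n. dist (b n) a) \<longlonglongrightarrow> 0"
    proof (rule tendsto_sandwich[of "\<lambda>_. 0" _ _ "\<lambda>n. 1 / real (Suc n)"])
      show "(\<lambda>n. 1 / real (Suc n)) \<longlonglongrightarrow> 0"
        by (rule LIMSEQ_Suc[OF lim_1_over_n])
      show "\<forall>\<^sub>F n in sequentially. dist (b n) a \<le> 1 / real (Suc n)"
        by (intro always_eventually allI less_imp_le bw(3))
    qed auto
    then have "b \<longlonglongrightarrow> a" by (rule iffD2[OF tendsto_dist_iff])
    then have "(b \<circ> r) \<longlonglongrightarrow> a" by (rule LIMSEQ_subseq_LIMSEQ[OF _ r(1)])
    then show ?thesis by (simp only: o_def)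
  qed
  ultimately have lim: "(\<lambda>n. (b (r n), w (r n))) \<longlonglongrightarrow> (a, u)" by (intro tendsto_Pair)
  have "(a, u) \<in> C" by (rule closed_sequentially[OF C _ lim]) (rule bw(1))
  then show ?thesis by blast
qed

text \<open>
  The key step of the capacitability theorem. The bounds are chosen one at a time: relaxing the next bound exhausts
  the set, so by continuity a sufficiently large bound keeps the value above \<open>e\<close>. With the
  previous lemma, the closures of the resulting sets shrink to a closed subset of the projection.
\<close>

lemma choquet_bounds:
  fixes \<gamma> :: "'a set \<Rightarrow> ennreal" and C :: "('a \<times> (nat \<Rightarrow> real)) set"
  assumes cont: "\<And>S. incseq S \<Longrightarrow> \<gamma> (\<Union>n. S n) = (SUP n. \<gamma> (S n))"
    and e: "e < \<gamma> {a. \<exists>w. (a, w) \<in> C}"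
  shows "\<exists>m. \<forall>k. e < \<gamma> (bounded_witness C m k)"
proof -
  define P where "P k m \<longleftrightarrow> e < \<gamma> (bounded_witness C m k)" for k m
  define Q where "Q k m m' \<longleftrightarrow> (\<forall>i<k. m' i = m i)" for k and m m' :: "nat \<Rightarrow> real"
  have "\<exists>M. \<forall>k. P k (M k) \<and> Q k (M k) (M (Suc k))"
  proof (rule dependent_nat_choice)
    show "\<exists>m. P 0 m" unfolding P_def bounded_witness_def using e by simp
  next
    fix m k assume "P k m"
    let ?S = "\<lambda>n. bounded_witness C (m(k := real n)) (Suc k)"
    have "incseq ?S"
      unfolding incseq_def bounded_witness_def by (fastforce simp: less_Suc_eq)
    moreover have "bounded_witness C m k = (\<Union>n. ?S n)"
    proof (intro set_eqI iffI)
      fix a assume "a \<in> bounded_witness C m k"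
      then obtain w where w: "(a, w) \<in> C" "\<forall>i<k. \<bar>w i\<bar> \<le> m i"
        unfolding bounded_witness_def by blast
      obtain n where "\<bar>w k\<bar> \<le> real n" using real_arch_simple by blast
      then have "a \<in> ?S n" unfolding bounded_witness_def using w by (auto simp: less_Suc_eq)
      then show "a \<in> (\<Union>n. ?S n)" by blast
    next
      fix a assume "a \<in> (\<Union>n. ?S n)"
      then show "a \<in> bounded_witness C m k"
        unfolding bounded_witness_def by (force simp: less_Suc_eq)
    qed
    ultimately have "e < (SUP n. \<gamma> (?S n))" using \<open>P k m\<close> cont unfolding P_def by metis
    then obtain n where "e < \<gamma> (?S n)" unfolding less_SUP_iff by blast
    then show "\<exists>m'. P (Suc k) m' \<and> Q k m m'"
      unfolding P_def Q_def by (intro exI[of _ "m(k := real n)"]) auto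
  qed
  then obtain M where M: "\<And>k. P k (M k)" "\<And>k. Q k (M k) (M (Suc k))" by blast
  have agree: "M k i = M (Suc i) i" if "i < k" for i k
    using that
  proof (induction k)
    case (Suc k)
    then show ?case using M(2)[of k] unfolding Q_def by (cases "i = k") auto
  qed simp
  have "(\<forall>i<k. \<bar>w i\<bar> \<le> M (Suc i) i) \<longleftrightarrow> (\<forall>i<k. \<bar>w i\<bar> \<le> M k i)" for k and w :: "nat \<Rightarrow> real"
    using agree[of _ k] by metis
  then have "bounded_witness C (\<lambda>i. M (Suc i) i) k = bounded_witness C (M k) k" for k
    unfolding bounded_witness_def by simp
  then have "e < \<gamma> (bounded_witness C (\<lambda>i. M (Suc i) i) k)" for k
    using M(1)[of k] unfolding P_def by simp
  then show ?thesis by blast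
qed


section \<open>From random translates to random covering sets\<close>

lemma closed_section:
  assumes "closed K"
  shows "closed {z. (x, z) \<in> K}"
proof -
  have "continuous_on UNIV (Pair x)" by (intro continuous_intros)
  then have "closed (Pair x -` K)" by (rule closed_vimage[OF assms])
  then show ?thesis by (simp add: vimage_def)
qed

lemma AE_if_outer_measure_0:
  assumes "outer_measure_of M B = 0" "B \<subseteq> space M"
  shows "AE x in M. x \<notin> B"
proof -
  obtain E where E: "E \<in> sets M" "B \<subseteq> E" "emeasure M E = 0"
    using outer_measure_of_attain[OF assms(2)] assms(1) by auto
  then have "AE x in M. x \<notin> E" by (intro AE_not_in null_setsI)
  then show ?thesis by eventually_elim (use E(2) in blast)
qed

text \<open>
  Suppose the sections have content above a threshold with positive outer probability. The
  closures of the sets with bounded witnesses then have sections that are large in the sense of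
  \<open>large_section\<close> on closed events \<open>B k\<close> of probability at least \<open>e > 0\<close>. These events decrease to a
  measurable event of positive probability. On it the intersection of the closures, which is
  contained in \<open>G\<close>, has a section of positive content. That contradicts the assumption
  by invariance under translations.
\<close>

lemma AE_section_content_null:
  fixes G :: "((nat \<Rightarrow> 'n::finite torus) \<times> 'n torus) set"
  defines "P \<equiv> PiM UNIV (\<lambda>_. torus_lebesgue :: 'n torus measure)"
  assumes G: "closed_projection G"
    and null: "AE x in P. AE a in torus_lebesgue. torus.content t {z. (\<lambda>n. x n + a, z) \<in> G} = 0"
  shows "AE x in P. torus.content t {z. (x, z) \<in> G} = 0"
proof -
  let ?N = "card (offsets :: (int^'n) set)"
  interpret Q: prob_space P unfolding P_def by (rule torus_product.prob_space_axioms)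
  have space_P: "space P = UNIV" unfolding P_def by (simp add: space_PiM)
  have sets_P: "sets P = sets borel" unfolding P_def by (rule sets_torus_product)
  \<comment> \<open>Positive content means content above one of countably many thresholds. The factor \<open>?N\<close> is lost in the
    passage to \<open>large_section\<close>.\<close>
  define c where "c j = ennreal (1 / real (Suc j))" for j
  define large where "large j H = {x. of_nat ?N * c j < torus.content t {z. (x, z) \<in> H}}"
    for j and H :: "((nat \<Rightarrow> 'n torus) \<times> 'n torus) set"
  have "outer_measure_of P (large j G) = 0" for j
  proof (rule ccontr)
    assume "outer_measure_of P (large j G) \<noteq> 0"
    then have "0 < outer_measure_of P (large j G)" by (simp add: zero_less_iff_neq_zero)
    then obtain e where e: "0 < e" "e < outer_measure_of P (large j G)" using dense by blast
    obtain C :: "(((nat \<Rightarrow> 'n torus) \<times> 'n torus) \<times> (nat \<Rightarrow> real)) set"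
      where C: "closed C" "\<forall>q. q \<in> G \<longleftrightarrow> (\<exists>w. (q, w) \<in> C)"
      using closed_projectionD[OF G] by blast
    have G_eq: "G = {q. \<exists>w. (q, w) \<in> C}" using C(2) by auto
    have "outer_measure_of P (large j (\<Union>n. S n)) = (SUP n. outer_measure_of P (large j (S n)))"
      if S: "incseq S" for S
    proof -
      have "torus.content t {z. (x, z) \<in> (\<Union>n. S n)} = (SUP n. torus.content t {z. (x, z) \<in> S n})" for x
      proof -
        have "incseq (\<lambda>n. {z. (x, z) \<in> S n})"
          using incseqD[OF S] unfolding incseq_def by blast
        moreover have "{z. (x, z) \<in> (\<Union>n. S n)} = (\<Union>n. {z. (x, z) \<in> S n})" by auto
        ultimately show ?thesis using torus.content_UN_incseq by metis
      qed
      then have "large j (\<Union>n. S n) = (\<Union>n. large j (S n))"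
        unfolding large_def less_SUP_iff[symmetric] by (auto simp: less_SUP_iff)
      moreover have "incseq (\<lambda>n. large j (S n))"
        unfolding incseq_def large_def
      proof (intro allI impI subsetI)
        fix k l x assume "k \<le> l" and x: "x \<in> {x. of_nat ?N * c j < torus.content t {z. (x, z) \<in> S k}}"
        then have "{z. (x, z) \<in> S k} \<subseteq> {z. (x, z) \<in> S l}" using incseqD[OF S] by blast
        then show "x \<in> {x. of_nat ?N * c j < torus.content t {z. (x, z) \<in> S l}}"
          using x torus.content_mono[of _ _ t] by (auto intro: less_le_trans)
      qed
      ultimately show ?thesis
        using SUP_outer_measure_of_incseq[of "\<lambda>n. large j (S n)" P] by (simp add: space_P)
    qed
    then obtain m where m: "\<And>k. e < outer_measure_of P (large j (bounded_witness C m k))"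
      using choquet_bounds[of "\<lambda>H. outer_measure_of P (large j H)" e C] e(2) unfolding G_eq by blast
    define K where "K k = closure (bounded_witness C m k)" for k
    define B where "B k = {x. large_section t (c j) {z. (x, z) \<in> K k}}" for k
    have K_dec: "decseq K"
      unfolding K_def decseq_def by (intro allI impI closure_mono bounded_witness_antimono)
    have B_closed: "closed (B k)" for k
      unfolding B_def K_def by (intro closed_large_sections closed_closure)
    have B_sets: "B k \<in> sets P" for k using B_closed[of k] by (simp add: sets_P)
    have B_dec: "decseq B"
      unfolding decseq_def
    proof (intro allI impI subsetI)
      fix k l x assume "k \<le> l" "x \<in> B l"
      moreover from this(1) have "{z. (x, z) \<in> K l} \<subseteq> {z. (x, z) \<in> K k}"
        using decseqD[OF K_dec] by blast
      ultimately show "x \<in> B k" unfolding B_def using large_section_mono by blast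
    qed
    have "e \<le> emeasure P (B k)" for k
    proof -
      have "large j (bounded_witness C m k) \<subseteq> B k"
      proof
        fix x assume "x \<in> large j (bounded_witness C m k)"
        then have "large_section t (c j) {z. (x, z) \<in> bounded_witness C m k}"
          unfolding large_def by (intro large_section_if_content) simp
        moreover have "{z. (x, z) \<in> bounded_witness C m k} \<subseteq> {z. (x, z) \<in> K k}"
          unfolding K_def using closure_subset by blast
        ultimately show "x \<in> B k" unfolding B_def using large_section_mono by blast
      qed
      then have "outer_measure_of P (large j (bounded_witness C m k)) \<le> emeasure P (B k)"
        using outer_measure_of_mono outer_measure_of_eq[OF B_sets[of k]] by metis
      then show ?thesis using m[of k] by simp
    qed
    moreover have "(INF k. emeasure P (B k)) = emeasure P (\<Inter>k. B k)"
      using B_sets B_dec by (intro INF_emeasure_decseq) auto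
    ultimately have "e \<le> emeasure P (\<Inter>k. B k)" by (metis INF_greatest)
    moreover have "emeasure P (\<Inter>k. B k) = 0"
      unfolding P_def
    proof (rule null_if_translates_null)
      show "(\<Inter>k. B k) \<in> sets borel" using B_closed by (intro borel_closed closed_INT) auto
      have bad: "torus.content t {z. (x, z) \<in> G} \<noteq> 0" if x: "x \<in> (\<Inter>k. B k)" for x
      proof -
        have K_closed: "closed {z. (x, z) \<in> K k}" for k
          unfolding K_def by (intro closed_section closed_closure)
        have dec: "decseq (\<lambda>k. {z. (x, z) \<in> K k})"
          using decseqD[OF K_dec] unfolding decseq_def by blast
        have lg: "large_section t (c j) {z. (x, z) \<in> K k}" for k
          using x unfolding B_def by blast
        have "large_section t (c j) (\<Inter>k. {z. (x, z) \<in> K k})"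
          by (rule large_section_INT[OF dec K_closed lg])
        moreover have "compact (\<Inter>k. {z. (x, z) \<in> K k})"
          using compact_Int_closed[OF compact_UNIV_torus closed_INT[of UNIV "\<lambda>k. {z. (x, z) \<in> K k}"]]
            K_closed by simp
        ultimately have "c j \<le> torus.content t (\<Inter>k. {z. (x, z) \<in> K k})"
          by (intro content_if_large_section)
        also have "\<dots> \<le> torus.content t {z. (x, z) \<in> G}"
        proof (rule torus.content_mono, rule subsetI)
          fix z assume "z \<in> (\<Inter>k. {z. (x, z) \<in> K k})"
          then have "(x, z) \<in> closure (bounded_witness C m k)" for k unfolding K_def by blast
          then have "\<exists>w. ((x, z), w) \<in> C" by (rule INT_closure_bounded_witness[OF C(1)])
          then show "z \<in> {z. (x, z) \<in> G}" using C(2) by simp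
        qed
        finally show ?thesis unfolding c_def by auto
      qed
      show "AE x in Pi\<^sub>M UNIV (\<lambda>_. torus_lebesgue). AE a in torus_lebesgue. (\<lambda>n. x n + a) \<notin> (\<Inter>k. B k)"
        using null unfolding P_def
      proof eventually_elim
        case (elim x)
        then show ?case by eventually_elim (use bad in blast)
      qed
    qed
    ultimately show False using e(1) by simp
  qed
  then have "AE x in P. \<forall>j. x \<notin> large j G"
    unfolding AE_all_countable by (intro allI AE_if_outer_measure_0) (auto simp: space_P)
  then show ?thesis
  proof eventually_elim
    case (elim x)
    let ?r = "torus.content t {z. (x, z) \<in> G}"
    show ?case
    proof (rule ccontr)
      assume "?r \<noteq> 0"
      then have "0 < ?r" by (simp add: zero_less_iff_neq_zero)
      then obtain b where b: "0 < b" "b < ?r" using dense by blast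
      then obtain r where r: "b = ennreal r" "0 < r"
        by (cases b rule: ennreal_cases) (auto simp: ennreal_less_zero_iff)
      obtain j where j: "1 / real (Suc j) < r / (real ?N + 1)"
        using nat_approx_posE[of "r / (real ?N + 1)"] r(2) by auto
      have "real ?N * (1 / real (Suc j)) \<le> (real ?N + 1) * (1 / real (Suc j))"
        by (intro mult_right_mono) auto
      also have "\<dots> \<le> r"
        using j by (simp add: less_divide_eq mult.commute less_imp_le)
      finally have "of_nat ?N * c j \<le> ennreal r"
        unfolding c_def ennreal_of_nat_eq_real_of_nat by (simp add: ennreal_leI flip: ennreal_mult)
      then have "x \<in> large j G" unfolding large_def using b(2) r(1) by simp
      then show False using elim by blast
    qed
  qed
qed

lemma mem_random_covering_set:
  "z \<in> random_covering_set A x \<longleftrightarrow> (\<forall>k. \<exists>j. z - x (k + j) \<in> torus_proj ` A (k + j))"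
proof -
  have "z \<in> (\<lambda>y. x n + y) ` torus_proj ` A n \<longleftrightarrow> z - x n \<in> torus_proj ` A n" for n
    by (force simp: algebra_simps image_iff)
  then have "z \<in> random_covering_set A x \<longleftrightarrow> (\<forall>k. \<exists>n\<ge>k. z - x n \<in> torus_proj ` A n)"
    unfolding random_covering_set_def by (simp add: Bex_def)
  also have "\<dots> \<longleftrightarrow> (\<forall>k. \<exists>j. z - x (k + j) \<in> torus_proj ` A (k + j))"
    by (metis le_Suc_ex le_add1)
  finally show ?thesis .
qed

lemma random_covering_set_translate:
  "random_covering_set A (\<lambda>n. x n + a) = (\<lambda>z. z + a) ` random_covering_set A x"
proof (intro set_eqI iffI)
  fix z assume "z \<in> random_covering_set A (\<lambda>n. x n + a)"
  then have "z - a \<in> random_covering_set A x"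
    unfolding mem_random_covering_set by (simp add: algebra_simps)
  then show "z \<in> (\<lambda>z. z + a) ` random_covering_set A x" by (intro image_eqI[of _ _ "z - a"]) auto
next
  fix z assume "z \<in> (\<lambda>z. z + a) ` random_covering_set A x"
  then show "z \<in> random_covering_set A (\<lambda>n. x n + a)"
    unfolding mem_random_covering_set by (auto simp: algebra_simps mem_random_covering_set)
qed

lemma analytic_set_image:
  assumes "analytic_set S" "continuous_on UNIV g"
  shows "analytic_set (g ` S)"
proof -
  obtain B :: "(nat \<Rightarrow> real) set" and f where B: "B \<in> sets borel" "continuous_on B f" "f ` B = S"
    using assms(1) unfolding analytic_set_def by blast
  have "continuous_on B (g \<circ> f)"
    using B(2) continuous_on_subset[OF assms(2)] by (intro continuous_on_compose) auto
  then show ?thesis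
    unfolding analytic_set_def using B by (intro exI[of _ B] exI[of _ "g \<circ> f"]) (auto simp: image_comp)
qed

text \<open>
  The limsup set is a countable intersection of countable unions of preimages of the sets \<open>A n\<close> under the
  continuous maps \<open>(x, z) \<mapsto> z - x n\<close>.
\<close>

lemma closed_projection_covering_graph:
  fixes A :: "nat \<Rightarrow> (real^'n::finite) set" and F :: "'n torus set"
  assumes A: "\<And>n. analytic_set (A n)" and F: "analytic_set F"
  shows "closed_projection {(x, z). z \<in> random_covering_set A x \<inter> F}"
proof -
  define d where "d n p = snd p - fst p n" for n and p :: "(nat \<Rightarrow> 'n torus) \<times> 'n torus"
  have "continuous_on UNIV (\<lambda>p :: (nat \<Rightarrow> 'n torus) \<times> 'n torus. fst p n)" for n
    by (rule continuous_on_product_then_coordinatewise[OF continuous_on_fst[OF continuous_on_id]])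
  then have d: "continuous_on UNIV (d n)" for n
    unfolding d_def by (intro continuous_on_diff continuous_on_snd continuous_on_id)
  have "closed_projection (torus_proj ` A n)" for n
    by (intro closed_projection_analytic analytic_set_image A continuous_on_torus_proj)
  then have "closed_projection ((\<Inter>k. \<Union>j. d (k + j) -` torus_proj ` A (k + j)) \<inter> snd -` F)"
    by (intro closed_projection_Int closed_projection_INT closed_projection_UN
        closed_projection_vimage[OF d] closed_projection_vimage[OF continuous_on_snd[OF continuous_on_id]]
        closed_projection_analytic[OF F])
  also have "(\<Inter>k. \<Union>j. d (k + j) -` torus_proj ` A (k + j)) \<inter> snd -` F
      = {(x, z). z \<in> random_covering_set A x \<inter> F}"
    unfolding d_def by (auto simp: mem_random_covering_set)
  finally show ?thesis .
qed

lemma AE_covering_content_null: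
  fixes A :: "nat \<Rightarrow> (real^'n::finite) set" and F :: "'n torus set" and s t :: real
  assumes A: "\<And>n. analytic_set (A n)" and F: "analytic_set F"
    and s: "AE x in torus_seq_measure. hausdorff_dim (random_covering_set A x) = ereal s"
    and t: "packing_dim F < ereal (t + real CARD('n) - s)"
  shows "AE x in torus_seq_measure. torus.content t (random_covering_set A x \<inter> F) = 0"
proof -
  let ?P = "PiM UNIV (\<lambda>_. torus_lebesgue :: 'n torus measure)"
  obtain p where p: "p < t + real CARD('n) - s" "packing_measure p F = 0"
    using t unfolding packing_dim_def Inf_less_iff by auto
  have "AE x in ?P. hausdorff_dim (random_covering_set A x) = ereal s"
    using s unfolding torus_seq_measure_def AE_completion_iff .
  then have "AE x in ?P. AE a in torus_lebesgue.
      torus.content t {z. (\<lambda>n. x n + a, z) \<in> {(x, z). z \<in> random_covering_set A x \<inter> F}} = 0"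
  proof eventually_elim
    case (elim x)
    have "hausdorff_dim (random_covering_set A x) < ereal (t + real CARD('n) - p)"
      using elim p(1) by simp
    then obtain s' where s': "0 \<le> s'" "s' < t + real CARD('n) - p"
      "hausdorff_measure s' (random_covering_set A x) = 0"
      unfolding hausdorff_dim_def Inf_less_iff by auto
    have "AE a in torus_lebesgue. torus.content t ((\<lambda>z. z + a) ` random_covering_set A x \<inter> F) = 0"
      using s' p(2) by (intro AE_translate_inter_content_null[of s' _ p]) auto
    then show ?case by (simp add: random_covering_set_translate Int_def)
  qed
  from AE_section_content_null[OF closed_projection_covering_graph[OF A F] this]
  show ?thesis unfolding torus_seq_measure_def AE_completion_iff by (simp add: Int_def)
qed

lemma content_0_null_imp_empty:
  fixes S :: "'n::finite torus set"
  assumes "torus.content 0 S = 0"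
  shows "S = {}"
proof -
  have "torus.content 0 S < 1" using assms by simp
  then obtain I where I: "S \<subseteq> torus.covered I" "weight 0 I < 1"
    by (rule torus.content_less_cover)
  have "I = {}"
  proof (rule ccontr)
    assume "I \<noteq> {}"
    then obtain q where "q \<in> I" by blast
    then have "scale_weight 0 q \<le> weight 0 I" by (rule scale_weight_le_weight)
    then show False using I(2) by (simp add: scale_weight_def)
  qed
  then show ?thesis using I(1) unfolding torus.covered_def by auto
qed

theorem theorem3p2:
  fixes A :: "nat \<Rightarrow> (real^'n::finite) set"
    and F :: "'n torus set"
    and s\<^sub>0 :: real
  assumes "\<And>n. A n \<subseteq> torus_cube"
    and "\<And>n. analytic_set (A n)"
    and "s\<^sub>0 \<in> {0..real CARD('n)}"
    and "AE x in torus_seq_measure. hausdorff_dim (random_covering_set A x) = ereal s\<^sub>0"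
    and "analytic_set F"
  shows "AE x in torus_seq_measure.
      (packing_dim F < ereal (real CARD('n) - s\<^sub>0) \<longrightarrow> random_covering_set A x \<inter> F = {}) \<and>
      (packing_dim F \<ge> ereal (real CARD('n) - s\<^sub>0) \<longrightarrow>
         hausdorff_dim (random_covering_set A x \<inter> F)
           \<le> ereal s\<^sub>0 + packing_dim F - ereal (real CARD('n)))"
proof -
  let ?d = "real CARD('n)"
  note null = AE_covering_content_null[OF assms(2,5,4)]
  show ?thesis
  proof (cases "packing_dim F < ereal (?d - s\<^sub>0)")
    case True
    then have "AE x in torus_seq_measure. torus.content 0 (random_covering_set A x \<inter> F) = 0"
      by (intro null) simp
    then show ?thesis
    proof eventually_elim
      case (elim x)
      then show ?case using content_0_null_imp_empty True by auto
    qed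
  next
    case False
    show ?thesis
    proof (cases "packing_dim F")
      case (real r)
      define u where "u = s\<^sub>0 + r - ?d"
      have u: "0 \<le> u" using False real by (simp add: u_def)
      \<comment> \<open>The bound holds for each dimension strictly above \<open>u\<close>; countably many of them suffice.\<close>
      have "AE x in torus_seq_measure.
          \<forall>n. torus.content (u + 1 / real (Suc n)) (random_covering_set A x \<inter> F) = 0"
        unfolding AE_all_countable by (intro allI null) (simp add: real u_def)
      then show ?thesis
      proof eventually_elim
        case (elim x)
        have le: "hausdorff_dim (random_covering_set A x \<inter> F) \<le> ereal (u + 1 / real (Suc n))" for n
          unfolding hausdorff_dim_def using elim u
          by (intro Inf_lower) (auto intro!: exI[of _ "u + 1 / real (Suc n)"] hausdorff_measure_eq_0)
        have "(\<lambda>n. ereal (u + 1 / real (Suc n))) \<longlonglongrightarrow> ereal (u + 0)"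
          by (intro tendsto_ereal tendsto_add tendsto_const LIMSEQ_Suc[OF lim_1_over_n])
        then have "hausdorff_dim (random_covering_set A x \<inter> F) \<le> ereal (u + 0)"
          by (rule LIMSEQ_le_const) (intro exI[of _ 0] allI impI le)
        then show ?case using False real by (simp add: u_def)
      qed
    qed (use False in auto)
  qed
qed

end
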